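(* Let $\Gamma$ be a finite two-person zero-sum stochastic game with states $1,\dots,N$, whose rewards $r(s,a,b)$ and transition probabilities $p(s'|s,a,b)$ all lie in the ordered field $\mathbb{F}$ of real algebraic numbers. For $\beta\in(0,1)$ let $\mathbf{v}(\beta)=(v_1(\beta),\dots,v_N(\beta))$ be the value vector of the $\beta$-discounted game $\Gamma_\beta$. Then there exist nonzero bivariate polynomials $g_s(z_0,z_s)\in\mathbb{F}[z_0,z_s]$, $s=1,\dots,N$ (each $g_s$ involving only the variables $z_0$ and $z_s$), such that the variety $$W_d=\{(z_0,z_1,\dots,z_N)\in\mathbb{C}^{N+1} : g_s(z_0,z_s)=0 \text{ for } s=1,\dots,N\}$$ contains the point $(\beta,v_1(\beta),\dots,v_N(\beta))$ for every $\beta\in(0,1)$. Furthermore, whenever $\beta\in(0,1)\cap\mathbb{F}$ (so that all the data of $\Gamma_\beta$ lie in $\mathbb{F}$), $v_s(\beta)$ is an algebraic number for each $s=1,\dots,N$.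
   Context: $\mathbb{F}$ denotes the ordered field of real algebraic numbers. Stochastic game: there are finitely many states $s=1,\dots,N$. In state $s$ player I chooses an action $a\in\{1,\dots,m_s\}$ and player II chooses an action $b\in\{1,\dots,n_s\}$ ($m_s,n_s\ge 1$ finite). Player II then pays player I the real amount $r(s,a,b)$, and the game moves to state $s'$ at the next stage with probability $p(s'|s,a,b)$, where $p(s'|s,a,b)\ge 0$ and $\sum_{s'=1}^N p(s'|s,a,b)=1$. A stationary strategy of player I is $\mu=(\mu(1),\dots,\mu(N))$ with $\mu(s)$ a probability distribution on $\{1,\dots,m_s\}$. A stationary strategy $\nu$ of player II is $\nu=(\nu(1),\dots,\nu(N))$ with $\nu(s)$ a probability distribution on $\{1,\dots,n_s\}$. An initial state $s$ and a pair $(\mu,\nu)$ determine a probability distribution over sequences of states and actions. Let $\mathcal{R}_t$ be the payoff to player I at stage $t=1,2,\dots$ and $E_{\mu\nu s}(\mathcal{R}_t)$ its expectation. For $\beta\in(0,1)$ the $\beta$-discounted game $\Gamma_\beta$ has payoff $v_\beta(\mu,\nu,s)=\sum_{t=1}^\infty \beta^{t-1}(1-\beta)E_{\mu\nu s}(\mathcal{R}_t)$. Its value from state $s$ is $v_s(\beta)=\sup_\mu\inf_\nu v_\beta(\mu,\nu,s)=\inf_\nu\sup_\mu v_\beta(\mu,\nu,s)$, which exists by a theorem of Shapley. Equivalently, $\mathbf{v}(\beta)$ is the unique $\mathbf{u}\in\mathbb{R}^N$ such that, for every $s$, $u_s$ equals the value of the matrix game with entries $(1-\beta)r(s,a,b)+\beta\sum_{s'=1}^N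 p(s'|s,a,b)u_{s'}$, $1\le a\le m_s$, $1\le b\le n_s$. Here the value of an $m\times n$ real matrix game $A$ is $\max_x\min_y x^TAy=\min_y\max_x x^TAy$ over probability vectors $x\in\mathbb{R}^m$, $y\in\mathbb{R}^n$. The data of $\Gamma_\beta$ are the numbers $r(s,a,b)$, $p(s'|s,a,b)$ and $\beta$. *)

theory Defs
  imports
    "HOL-Probability.Probability"
    "HOL-Computational_Algebra.Polynomial"
begin

(* The type 's is the set of states, so that N = CARD('s).  In state s the actions are
   {1..actsI G s} and {1..actsII G s}; rewards and transitions at other indices are junk
   and are never used.  The transition probability p(s'|s,a,b) is pmf (trans G s a b) s'. *)
record 's stochastic_game =
  actsI :: "'s \<Rightarrow> nat"
  actsII :: "'s \<Rightarrow> nat"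
  reward :: "'s \<Rightarrow> nat \<Rightarrow> nat \<Rightarrow> real"
  trans :: "'s \<Rightarrow> nat \<Rightarrow> nat \<Rightarrow> 's pmf"

definition stochastic_game :: "('s::finite) stochastic_game \<Rightarrow> bool" where
  "stochastic_game G \<longleftrightarrow> (\<forall>s. actsI G s \<ge> 1 \<and> actsII G s \<ge> 1)"

definition strategiesI :: "('s::finite) stochastic_game \<Rightarrow> ('s \<Rightarrow> nat pmf) set" where
  "strategiesI G = {\<mu>. \<forall>s. set_pmf (\<mu> s) \<subseteq> {1..actsI G s}}"

definition strategiesII :: "('s::finite) stochastic_game \<Rightarrow> ('s \<Rightarrow> nat pmf) set" where
  "strategiesII G = {\<nu>. \<forall>s. set_pmf (\<nu> s) \<subseteq> {1..actsII G s}}"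

(* play G \<mu> \<nu> t s is the law of the first t triples (state, action of I, action of II)
   of the play started in s, i.e. the marginal on the first t stages of the distribution
   over infinite plays.  The payoff at stage t depends on these stages only. *)
primrec play ::
  "('s::finite) stochastic_game \<Rightarrow> ('s \<Rightarrow> nat pmf) \<Rightarrow> ('s \<Rightarrow> nat pmf) \<Rightarrow> nat \<Rightarrow> 's
     \<Rightarrow> ('s \<times> nat \<times> nat) list pmf" where
  "play G \<mu> \<nu> 0 s = return_pmf []"
| "play G \<mu> \<nu> (Suc t) s =
     bind_pmf (\<mu> s) (\<lambda>a. bind_pmf (\<nu> s) (\<lambda>b. bind_pmf (trans G s a b) (\<lambda>s'.
       map_pmf (\<lambda>h. (s, a, b) # h) (play G \<mu> \<nu> t s'))))"

(* The payoff at stage t = 1, 2, ... as a function of the history; lists are indexed from 0. *)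
definition stage_payoff ::
  "('s::finite) stochastic_game \<Rightarrow> nat \<Rightarrow> ('s \<times> nat \<times> nat) list \<Rightarrow> real" where
  "stage_payoff G t h = (case h ! (t - 1) of (s, a, b) \<Rightarrow> reward G s a b)"

definition expected_stage_payoff ::
  "('s::finite) stochastic_game \<Rightarrow> ('s \<Rightarrow> nat pmf) \<Rightarrow> ('s \<Rightarrow> nat pmf) \<Rightarrow> 's \<Rightarrow> nat \<Rightarrow> real" where
  "expected_stage_payoff G \<mu> \<nu> s t =
     measure_pmf.expectation (play G \<mu> \<nu> t s) (stage_payoff G t)"

(* The summation index is shifted by one: stage t = Suc k. *)
definition discounted_payoff ::
  "('s::finite) stochastic_game \<Rightarrow> real \<Rightarrow> ('s \<Rightarrow> nat pmf) \<Rightarrow> ('s \<Rightarrow> nat pmf) \<Rightarrow> 's \<Rightarrow> real" where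
  "discounted_payoff G \<beta> \<mu> \<nu> s =
     (\<Sum>k. \<beta> ^ k * (1 - \<beta>) * expected_stage_payoff G \<mu> \<nu> s (Suc k))"

(* By Shapley's theorem sup inf = inf sup for 0 < \<beta> < 1; the sup inf form is taken as the
   definition.  All payoffs are bounded by the largest absolute reward, so that the real
   suprema and infima are genuine ones. *)
definition discounted_value :: "('s::finite) stochastic_game \<Rightarrow> real \<Rightarrow> 's \<Rightarrow> real" where
  "discounted_value G \<beta> s =
     (SUP \<mu>\<in>strategiesI G. INF \<nu>\<in>strategiesII G. discounted_payoff G \<beta> \<mu> \<nu> s)"

definition real_algebraic_numbers :: "real set" where
  "real_algebraic_numbers = {x. algebraic x}"

definition algebraic_game :: "('s::finite) stochastic_game \<Rightarrow> bool" where
  "algebraic_game G \<longleftrightarrow>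
     (\<forall>s. \<forall>a\<in>{1..actsI G s}. \<forall>b\<in>{1..actsII G s}.
        reward G s a b \<in> real_algebraic_numbers \<and>
        (\<forall>s'. pmf (trans G s a b) s' \<in> real_algebraic_numbers))"

(* A bivariate polynomial g(z0, z) is an element of R[z0][z]: the inner variable is z0, the
   outer one is z. *)
definition algebraic_coeffs :: "real poly poly \<Rightarrow> bool" where
  "algebraic_coeffs g \<longleftrightarrow> (\<forall>i j. coeff (coeff g i) j \<in> real_algebraic_numbers)"

definition eval_bivariate :: "real poly poly \<Rightarrow> complex \<Rightarrow> complex \<Rightarrow> complex" where
  "eval_bivariate g z0 z = poly (poly (map_poly (map_poly complex_of_real) g) [:z:]) z0"

(* A point (z_0, z_1, ..., z_N) of complex (N+1)-space is the pair of z_0 and (z_1, ..., z_N). *)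
definition variety_W :: "('s::finite \<Rightarrow> real poly poly) \<Rightarrow> (complex \<times> (complex ^ 's)) set" where
  "variety_W g = {(z0, z). \<forall>s. eval_bivariate (g s) z0 (z $ s) = 0}"

end

theory Submission
  imports Defs "HOL-Library.Function_Algebras"
begin

text \<open>
  For a fixed discount factor, let \<open>T\<close> be the Shapley operator, which sends \<open>u\<close> to the vector of
  values of the one-stage games whose continuation is worth \<open>u\<close>. It is a \<open>\<beta>\<close>-contraction for the
  maximum norm, and the value vector \<open>v\<close> of the discounted game is its fixed point
  (\<open>discounted_value_eq_fixpoint\<close>).

  The value of a matrix game is the optimum of a linear program. Fourier-Motzkin elimination solves
  such a program by field operations and sign tests alone, so the value is given at each point
  by one of finitely many fractions \<open>n / D\<close> of polynomials in the entries
  (\<open>piecewise_rational_Sup_feasible\<close>). Hence \<open>(\<beta>, v)\<close> satisfies one of finitely many systems of \<open>N\<close>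
  polynomial equations in \<open>N + 1\<close> unknowns. Such a system may have solution components of
  excessive dimension, and eliminating unknowns from it directly may yield nothing.

  The way out is a perturbation. For every vector \<open>w\<close> the equation \<open>u = w + T u\<close> has a solution
  (\<open>perturbed_shapley_fixpoint_exists\<close>), and by contraction it converges to \<open>v\<close> as \<open>w\<close> tends to \<open>0\<close>
  (\<open>shapley_fixpoint_stable\<close>). Read backwards, \<open>w s = u s - T u s\<close> is a piecewise rational function of
  the \<open>N + 1\<close> variables \<open>\<beta>\<close> and \<open>u\<close>. The \<open>N + 2\<close> functions \<open>\<beta>\<close>, \<open>w\<close> and \<open>u s0\<close> of these
  variables therefore satisfy, for each choice of fractions, a nontrivial polynomial relation
  \<open>p (\<beta>, w, u s0) = 0\<close>: there are more monomials in them than dimensions available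
  (\<open>algebraic_dependence\<close>). Put \<open>w s = \<epsilon> ^ \<omega> s\<close> with weights \<open>\<omega>\<close> so chosen that distinct monomials in \<open>w\<close> turn
  into distinct powers of \<open>\<epsilon>\<close>. Then the coefficient of the lowest power of \<open>\<epsilon>\<close> is a
  nonzero polynomial in \<open>\<beta>\<close> and \<open>u s0\<close>, and dividing by that power and letting \<open>\<epsilon>\<close> tend to
  \<open>0\<close> shows that it vanishes at \<open>(\<beta>, v s0)\<close> (\<open>lowest_order_coefficient\<close>, \<open>elimination\<close>). The product over
  the finitely many choices of fractions vanishes at \<open>(\<beta>, v s0)\<close> for every \<open>\<beta>\<close>.

  The data are algebraic, so they lie in an algebra of finite dimension over the rationals, and the
  dimension count can be made over the rationals. The polynomials obtained have rational
  coefficients. If \<open>\<beta>\<close> itself is algebraic, it can be put among the data instead of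
  the variables, and the same argument gives a nonzero polynomial in one variable, with rational
  coefficients, that vanishes at \<open>v s0\<close>.
\<close>

section \<open>Piecewise rational functions\<close>

text \<open>The ring will consist of the polynomial functions whose coefficients come from the algebra that
  the data generate.\<close>
locale function_ring =
  fixes P :: "('x \<Rightarrow> real) set"
  assumes one_closed: "(\<lambda>_. 1) \<in> P"
    and diff_closed: "f \<in> P \<Longrightarrow> g \<in> P \<Longrightarrow> (\<lambda>x. f x - g x) \<in> P"
    and mult_closed: "f \<in> P \<Longrightarrow> g \<in> P \<Longrightarrow> (\<lambda>x. f x * g x) \<in> P"
begin

lemma zero_closed: "(\<lambda>_. 0) \<in> P"
  using diff_closed[OF one_closed one_closed] by simp

lemma uminus_closed: "f \<in> P \<Longrightarrow> (\<lambda>x. - f x) \<in> P"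
  using diff_closed[OF zero_closed] by simp

lemma add_closed: "f \<in> P \<Longrightarrow> g \<in> P \<Longrightarrow> (\<lambda>x. f x + g x) \<in> P"
  using diff_closed[OF _ uminus_closed] by simp

lemma sum_closed: "(\<And>i. i \<in> I \<Longrightarrow> f i \<in> P) \<Longrightarrow> (\<lambda>x. \<Sum>i\<in>I. f i x) \<in> P"
  by (induction I rule: infinite_finite_induct) (auto intro: zero_closed add_closed)

text \<open>The pieces, on which one fraction represents \<open>h\<close>, are arbitrary sets. This is what makes the class
  closed under division with \<open>x / 0 = 0\<close> and under any finite case distinction, so that every
  algorithm made of field operations and finitely many branchings computes functions of this class.\<close>
definition piecewise_rational :: "'x set \<Rightarrow> ('x \<Rightarrow> real) \<Rightarrow> bool" where
  "piecewise_rational X h \<longleftrightarrow> (\<exists>R. finite R \<and> R \<subseteq> P \<times> P \<and>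
     (\<forall>x\<in>X. \<exists>n D. (n, D) \<in> R \<and> D x \<noteq> 0 \<and> D x * h x = n x))"

lemma piecewise_rationalI:
  assumes "finite R" "R \<subseteq> P \<times> P"
    and "\<And>x. x \<in> X \<Longrightarrow> \<exists>n D. (n, D) \<in> R \<and> D x \<noteq> 0 \<and> D x * h x = n x"
  shows "piecewise_rational X h"
  unfolding piecewise_rational_def using assms by (intro exI[of _ R] conjI ballI)

lemma piecewise_rationalE:
  assumes "piecewise_rational X h"
  obtains R where "finite R" "R \<subseteq> P \<times> P"
    "\<And>x. x \<in> X \<Longrightarrow> \<exists>n D. (n, D) \<in> R \<and> D x \<noteq> 0 \<and> D x * h x = n x"
  using assms unfolding piecewise_rational_def by (elim exE conjE) (erule (1) that, erule (1) bspec)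

lemma piecewise_rational_ring: "f \<in> P \<Longrightarrow> piecewise_rational X f"
  by (rule piecewise_rationalI[of "{(f, \<lambda>_. 1)}"]) (auto intro: one_closed)

lemma piecewise_rational_cong:
  assumes "piecewise_rational X h" "\<And>x. x \<in> X \<Longrightarrow> h x = h' x"
  shows "piecewise_rational X h'"
  using assms(1)
proof (rule piecewise_rationalE)
  fix R assume R: "finite R" "R \<subseteq> P \<times> P"
    "\<And>x. x \<in> X \<Longrightarrow> \<exists>n D. (n, D) \<in> R \<and> D x \<noteq> 0 \<and> D x * h x = n x"
  show ?thesis
    by (rule piecewise_rationalI[OF R(1,2)]) (use R(3) assms(2) in metis)
qed

lemma piecewise_rational_subset:
  assumes "piecewise_rational X h" "Y \<subseteq> X"
  shows "piecewise_rational Y h"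
  using assms(1)
  by (rule piecewise_rationalE) (rule piecewise_rationalI, use assms(2) in auto)

lemma piecewise_rational_UN:
  assumes "finite I" "\<And>i. i \<in> I \<Longrightarrow> piecewise_rational (X i) h"
  shows "piecewise_rational (\<Union>i\<in>I. X i) h"
proof -
  have "\<forall>i\<in>I. \<exists>R. finite R \<and> R \<subseteq> P \<times> P \<and>
      (\<forall>x\<in>X i. \<exists>n D. (n, D) \<in> R \<and> D x \<noteq> 0 \<and> D x * h x = n x)"
    using assms(2) unfolding piecewise_rational_def by (rule ballI)
  then obtain R where R: "\<forall>i\<in>I. finite (R i) \<and> R i \<subseteq> P \<times> P \<and>
      (\<forall>x\<in>X i. \<exists>n D. (n, D) \<in> R i \<and> D x \<noteq> 0 \<and> D x * h x = n x)"
    by (rule bchoice[THEN exE])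
  show ?thesis
  proof (rule piecewise_rationalI)
    show "finite (\<Union>i\<in>I. R i)" using R assms(1) by (intro finite_UN_I) auto
    show "(\<Union>i\<in>I. R i) \<subseteq> P \<times> P" using R by (intro UN_least) auto
    fix x assume "x \<in> (\<Union>i\<in>I. X i)"
    then obtain i where i: "i \<in> I" "x \<in> X i" by (elim UN_E)
    with R obtain n D where "(n, D) \<in> R i" "D x \<noteq> 0 \<and> D x * h x = n x" by metis
    with i(1) show "\<exists>n D. (n, D) \<in> (\<Union>i\<in>I. R i) \<and> D x \<noteq> 0 \<and> D x * h x = n x"
      by (intro exI[of _ n] exI[of _ D]) auto
  qed
qed

text \<open>The common shape of the closure properties under addition and multiplication: a formula
  for the numerator of the result turns a pair of finite lists of fractions into one.\<close>
lemma piecewise_rational_binop: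
  assumes "piecewise_rational X f" "piecewise_rational X g"
    and N: "\<And>n D n' D'. n \<in> P \<Longrightarrow> D \<in> P \<Longrightarrow> n' \<in> P \<Longrightarrow> D' \<in> P \<Longrightarrow>
       (\<lambda>x. N (n x) (D x) (n' x) (D' x)) \<in> P"
    and eq: "\<And>a d b e. N (d * a) d (e * b) e = d * e * F a b"
  shows "piecewise_rational X (\<lambda>x. F (f x) (g x))"
proof -
  obtain R where R: "finite R" "R \<subseteq> P \<times> P"
      "\<And>x. x \<in> X \<Longrightarrow> \<exists>n D. (n, D) \<in> R \<and> D x \<noteq> 0 \<and> D x * f x = n x"
    using assms(1) by (rule piecewise_rationalE) blast
  obtain S where S: "finite S" "S \<subseteq> P \<times> P"
      "\<And>x. x \<in> X \<Longrightarrow> \<exists>n D. (n, D) \<in> S \<and> D x \<noteq> 0 \<and> D x * g x = n x"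
    using assms(2) by (rule piecewise_rationalE) blast
  define T where "T = (\<lambda>((n, D), (n', D')). ((\<lambda>x. N (n x) (D x) (n' x) (D' x)),
      (\<lambda>x. D x * D' x))) ` (R \<times> S)"
  show ?thesis
  proof (rule piecewise_rationalI)
    show "finite T" unfolding T_def using R(1) S(1) by blast
    show "T \<subseteq> P \<times> P" unfolding T_def using R(2) S(2) by (auto intro!: N mult_closed)
    fix x assume x: "x \<in> X"
    obtain n D where 1: "(n, D) \<in> R" "D x \<noteq> 0" "D x * f x = n x" using R(3)[OF x] by blast
    obtain n' D' where 2: "(n', D') \<in> S" "D' x \<noteq> 0" "D' x * g x = n' x" using S(3)[OF x] by blast
    have "((\<lambda>x. N (n x) (D x) (n' x) (D' x)), (\<lambda>x. D x * D' x)) \<in> T"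
      unfolding T_def using 1(1) 2(1) by force
    moreover have "D x * D' x * F (f x) (g x) = N (n x) (D x) (n' x) (D' x)"
      using eq[of "D x" "f x" "D' x" "g x"] 1 2 by simp
    ultimately show "\<exists>n D. (n, D) \<in> T \<and> D x \<noteq> 0 \<and> D x * F (f x) (g x) = n x"
      using 1(2) 2(2) by (intro exI[of _ "\<lambda>x. N (n x) (D x) (n' x) (D' x)"] exI[of _ "\<lambda>x. D x * D' x"]) auto
  qed
qed

lemma piecewise_rational_diff:
  assumes "piecewise_rational X f" "piecewise_rational X g"
  shows "piecewise_rational X (\<lambda>x. f x - g x)"
  using assms by (rule piecewise_rational_binop[where N = "\<lambda>n D n' D'. n * D' - n' * D"])
    (auto intro: diff_closed mult_closed simp: algebra_simps)

lemma piecewise_rational_mult: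
  assumes "piecewise_rational X f" "piecewise_rational X g"
  shows "piecewise_rational X (\<lambda>x. f x * g x)"
  using assms by (rule piecewise_rational_binop[where N = "\<lambda>n D n' D'. n * n'"])
    (auto intro: mult_closed)

lemma piecewise_rational_inverse:
  assumes "piecewise_rational X f"
  shows "piecewise_rational X (\<lambda>x. inverse (f x))"
proof -
  obtain R where R: "finite R" "R \<subseteq> P \<times> P"
      "\<And>x. x \<in> X \<Longrightarrow> \<exists>n D. (n, D) \<in> R \<and> D x \<noteq> 0 \<and> D x * f x = n x"
    using assms(1) by (rule piecewise_rationalE) blast
  \<comment> \<open>The fraction \<open>0 / 1\<close> serves the points with \<open>f x = 0\<close>, where the inverse is \<open>0\<close> by convention.\<close>
  define T where "T = insert ((\<lambda>_. 0), (\<lambda>_. 1)) (prod.swap ` R)"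
  show ?thesis
  proof (rule piecewise_rationalI)
    show "finite T" "T \<subseteq> P \<times> P" unfolding T_def using R(1,2) one_closed zero_closed by auto
    fix x assume x: "x \<in> X"
    obtain n D where 1: "(n, D) \<in> R" "D x \<noteq> 0" "D x * f x = n x" using R(3)[OF x] by blast
    show "\<exists>n D. (n, D) \<in> T \<and> D x \<noteq> 0 \<and> D x * inverse (f x) = n x"
    proof (cases "f x = 0")
      case True
      then show ?thesis
        by (intro exI[of _ "\<lambda>_. 0"] exI[of _ "\<lambda>_. 1"]) (simp add: T_def)
    next
      case False
      have "(D, n) \<in> T" using 1(1) by (force simp: T_def)
      moreover have "n x \<noteq> 0 \<and> n x * inverse (f x) = D x" using False 1 by (auto simp flip: 1(3))
      ultimately show ?thesis by blast
    qed
  qed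
qed

lemma piecewise_rational_divide:
  "piecewise_rational X f \<Longrightarrow> piecewise_rational X g \<Longrightarrow> piecewise_rational X (\<lambda>x. f x / g x)"
  unfolding divide_inverse by (intro piecewise_rational_mult piecewise_rational_inverse)

section \<open>Fourier-Motzkin elimination\<close>

text \<open>A constraint \<open>(a, p, q)\<close> stands for the inequality
  \<open>(\<Sum>j. a j x * z j) + p x * v \<le> q x\<close> in the unknowns \<open>z j\<close> and \<open>v\<close>.\<close>
definition feasible ::
  "'j set \<Rightarrow> (('j \<Rightarrow> 'x \<Rightarrow> real) \<times> ('x \<Rightarrow> real) \<times> ('x \<Rightarrow> real)) set \<Rightarrow> 'x \<Rightarrow> real set" where
  "feasible V C x = {v. \<exists>z. \<forall>(a, p, q)\<in>C. (\<Sum>j\<in>V. a j x * z j) + p x * v \<le> q x}"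

end

lemma ex_between:
  fixes L U :: "real set"
  assumes "finite L" "finite U" "\<And>l u. l \<in> L \<Longrightarrow> u \<in> U \<Longrightarrow> l \<le> u"
  shows "\<exists>t. (\<forall>l\<in>L. l \<le> t) \<and> (\<forall>u\<in>U. t \<le> u)"
proof (cases "L = {}")
  case True
  show ?thesis
  proof (cases "U = {}")
    case False
    then show ?thesis using True assms(2) by (intro exI[of _ "Min U"]) auto
  qed (use True in auto)
next
  case False
  then show ?thesis using assms by (intro exI[of _ "Max L"]) auto
qed

context function_ring
begin

text \<open>With no unknown but \<open>v\<close> left, the supremum is the least of the bounds \<open>q x / p x\<close> that constraints
  with a positive coefficient impose.\<close>
lemma piecewise_rational_Sup_feasible_base:
  fixes C :: "(('j \<Rightarrow> 'x \<Rightarrow> real) \<times> ('x \<Rightarrow> real) \<times> ('x \<Rightarrow> real)) set"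
  assumes "finite C"
    and C: "\<And>a p q. (a, p, q) \<in> C \<Longrightarrow> piecewise_rational X p \<and> piecewise_rational X q"
    and h: "\<And>x. x \<in> X \<Longrightarrow> feasible {} C x \<noteq> {} \<and> bdd_above (feasible {} C x) \<and>
                        h x = Sup (feasible {} C x)"
  shows "piecewise_rational X h"
proof -
  define Y where "Y = (\<lambda>(a :: 'j \<Rightarrow> 'x \<Rightarrow> real, p, q). {x \<in> X. h x = q x / p x})"
  have "piecewise_rational (\<Union>c\<in>C. Y c) h"
  proof (rule piecewise_rational_UN[OF assms(1)])
    fix c assume "c \<in> C"
    then obtain a p q where c: "c = (a, p, q)" "(a, p, q) \<in> C" by (cases c) auto
    have "piecewise_rational (Y c) (\<lambda>x. q x / p x)"
      using C[OF c(2)] by (intro piecewise_rational_subset[OF piecewise_rational_divide, of X])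
        (auto simp: Y_def c)
    then show "piecewise_rational (Y c) h"
      by (rule piecewise_rational_cong) (auto simp: Y_def c)
  qed
  moreover have "x \<in> (\<Union>c\<in>C. Y c)" if x: "x \<in> X" for x
  proof -
    define S where "S = feasible {} C x"
    have S: "v \<in> S \<longleftrightarrow> (\<forall>(a, p, q)\<in>C. p x * v \<le> q x)" for v
      by (auto simp: S_def feasible_def)
    obtain v0 where v0: "v0 \<in> S" using h[OF x] by (auto simp: S_def)
    define U where "U = (\<lambda>(a :: 'j \<Rightarrow> 'x \<Rightarrow> real, p, q). q x / p x) ` {(a, p, q) \<in> C. p x > 0}"
    have finU: "finite U" unfolding U_def
      by (intro finite_imageI finite_subset[OF _ assms(1)]) auto
    have le: "v \<le> u" if "v \<in> S" "u \<in> U" for u v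
      using that by (auto simp: U_def S field_simps)
    \<comment> \<open>Above the feasible point \<open>v0\<close>, only the constraints with a positive coefficient matter.\<close>
    have memS: "v \<in> S" if v: "v0 \<le> v" "\<And>u. u \<in> U \<Longrightarrow> v \<le> u" for v
      unfolding S
    proof (clarify)
      fix a p q assume c: "(a, p, q) \<in> C"
      show "p x * v \<le> q x"
      proof (cases "p x > 0")
        case True
        then have "q x / p x \<in> U" unfolding U_def using c by force
        with v(2) have "v \<le> q x / p x" by blast
        with True show ?thesis by (simp add: field_simps)
      next
        case False
        then have "p x * v \<le> p x * v0" using v(1) by (intro mult_left_mono_neg) auto
        also have "\<dots> \<le> q x" using v0 c by (auto simp: S)
        finally show ?thesis .
      qed
    qed
    have "U \<noteq> {}"
    proof
      assume "U = {}"
      obtain B where "\<And>v. v \<in> S \<Longrightarrow> v \<le> B" using h[OF x] by (auto simp: S_def bdd_above_def)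
      moreover have "max v0 (B + 1) \<in> S" using \<open>U = {}\<close> by (intro memS) auto
      ultimately show False by fastforce
    qed
    have "Sup S = Min U"
      using \<open>U \<noteq> {}\<close> finU le v0 by (intro cSup_eq_maximum memS) auto
    then have "h x \<in> U" using h[OF x] Min_in[OF finU \<open>U \<noteq> {}\<close>] by (simp add: S_def)
    then show ?thesis using x by (force simp: U_def Y_def)
  qed
  ultimately show ?thesis by (rule piecewise_rational_subset[OF _ subsetI])
qed

text \<open>The sum of two constraints, scaled such that the unknown \<open>j\<close> cancels; it is a valid
  consequence of both if its coefficient is positive in the first and negative in the second.\<close>
definition combine ::
  "'j \<Rightarrow> ('j \<Rightarrow> 'x \<Rightarrow> real) \<times> ('x \<Rightarrow> real) \<times> ('x \<Rightarrow> real) \<Rightarrow>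
   ('j \<Rightarrow> 'x \<Rightarrow> real) \<times> ('x \<Rightarrow> real) \<times> ('x \<Rightarrow> real) \<Rightarrow>
   ('j \<Rightarrow> 'x \<Rightarrow> real) \<times> ('x \<Rightarrow> real) \<times> ('x \<Rightarrow> real)" where
  "combine j = (\<lambda>(a, p, q) (a', p', q').
     ((\<lambda>i x. a i x / a j x - a' i x / a' j x),
      (\<lambda>x. p x / a j x - p' x / a' j x),
      (\<lambda>x. q x / a j x - q' x / a' j x)))"

text \<open>The Fourier-Motzkin step: constraints in \<open>A\<close> bound the unknown \<open>j\<close> from above, those in \<open>B\<close> from
  below, and a suitable value of that unknown exists if and only if every lower bound is at most every upper bound.\<close>
lemma feasible_eliminate:
  fixes C :: "(('j \<Rightarrow> 'x \<Rightarrow> real) \<times> ('x \<Rightarrow> real) \<times> ('x \<Rightarrow> real)) set"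
  assumes "finite V" "j \<notin> V" "finite C"
    and A: "A = {(a, p, q) \<in> C. a j x > 0}" and B: "B = {(a, p, q) \<in> C. a j x < 0}"
  shows "feasible (insert j V) C x =
         feasible V ((C - A - B) \<union> (\<lambda>(c, c'). combine j c c') ` (A \<times> B)) x" (is "_ = feasible V ?C' x")
proof -
  have "(\<exists>z. \<forall>(a, p, q)\<in>C. (\<Sum>i\<in>insert j V. a i x * z i) + p x * v \<le> q x) \<longleftrightarrow>
        (\<exists>z. \<forall>(a, p, q)\<in>?C'. (\<Sum>i\<in>V. a i x * z i) + p x * v \<le> q x)" for v
  proof -
    \<comment> \<open>\<open>bnd z c\<close> is the bound that constraint \<open>c\<close> puts on the eliminated unknown.\<close>
    define bnd where "bnd = (\<lambda>z (a :: 'j \<Rightarrow> 'x \<Rightarrow> real, p, q). (q x - p x * v - (\<Sum>i\<in>V. a i x * z i)) / a j x)"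
    define rest where "rest z \<longleftrightarrow> (\<forall>(a, p, q)\<in>C - A - B. (\<Sum>i\<in>V. a i x * z i) + p x * v \<le> q x)" for z
    have comb: "(case combine j c c' of (a, p, q) \<Rightarrow> (\<Sum>i\<in>V. a i x * z i) + p x * v \<le> q x)
        \<longleftrightarrow> bnd z c' \<le> bnd z c" for c c' z
    proof -
      obtain a p q a' p' q' where c: "c = (a, p, q)" "c' = (a', p', q')" by (cases c, cases c') auto
      have "(\<Sum>i\<in>V. (a i x / a j x - a' i x / a' j x) * z i) =
          (\<Sum>i\<in>V. a i x * z i) / a j x - (\<Sum>i\<in>V. a' i x * z i) / a' j x"
        by (simp add: sum_subtractf left_diff_distrib sum_divide_distrib)
      then show ?thesis
        by (simp add: c combine_def bnd_def diff_divide_distrib left_diff_distrib) linarith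
    qed
    have R: "(\<forall>(a, p, q)\<in>?C'. (\<Sum>i\<in>V. a i x * z i) + p x * v \<le> q x) \<longleftrightarrow>
        rest z \<and> (\<forall>c\<in>A. \<forall>c'\<in>B. bnd z c' \<le> bnd z c)" for z
      unfolding rest_def ball_Un by (simp add: comb)
    have L: "(\<forall>(a, p, q)\<in>C. (\<Sum>i\<in>insert j V. a i x * z i) + p x * v \<le> q x) \<longleftrightarrow>
        rest z \<and> (\<forall>c\<in>A. z j \<le> bnd z c) \<and> (\<forall>c\<in>B. bnd z c \<le> z j)" for z
    proof -
      have 1: "(\<Sum>i\<in>insert j V. a i x * z i) + p x * v \<le> q x \<longleftrightarrow> z j \<le> bnd z (a, p, q)"
        if "(a, p, q) \<in> A" for a p q
        using that assms(1,2) by (simp add: A bnd_def field_simps)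
      have 2: "(\<Sum>i\<in>insert j V. a i x * z i) + p x * v \<le> q x \<longleftrightarrow> bnd z (a, p, q) \<le> z j"
        if "(a, p, q) \<in> B" for a p q
        using that assms(1,2) by (simp add: B bnd_def field_simps)
      have 3: "(\<Sum>i\<in>insert j V. a i x * z i) = (\<Sum>i\<in>V. a i x * z i)"
        if "(a, p, q) \<in> C - A - B" for a p q
      proof -
        have "a j x = 0" using that by (auto simp: A B)
        then show ?thesis using assms(1,2) by simp
      qed
      have "A \<subseteq> C" "B \<subseteq> C" by (auto simp: A B)
      then have "(\<forall>c\<in>C. Q c) \<longleftrightarrow> (\<forall>c\<in>C - A - B. Q c) \<and> (\<forall>c\<in>A. Q c) \<and> (\<forall>c\<in>B. Q c)" for Q
        by blast
      then have "(\<forall>(a, p, q)\<in>C. (\<Sum>i\<in>insert j V. a i x * z i) + p x * v \<le> q x) \<longleftrightarrow>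
        (\<forall>(a, p, q)\<in>C - A - B. (\<Sum>i\<in>insert j V. a i x * z i) + p x * v \<le> q x) \<and>
        (\<forall>(a, p, q)\<in>A. (\<Sum>i\<in>insert j V. a i x * z i) + p x * v \<le> q x) \<and>
        (\<forall>(a, p, q)\<in>B. (\<Sum>i\<in>insert j V. a i x * z i) + p x * v \<le> q x)" .
      also have "\<dots> \<longleftrightarrow> rest z \<and> (\<forall>c\<in>A. z j \<le> bnd z c) \<and> (\<forall>c\<in>B. bnd z c \<le> z j)"
        unfolding rest_def
        by (intro conj_cong ball_cong refl; clarify) (subst 3, simp, rule refl, simp_all only: 1 2)
      finally show ?thesis .
    qed
    have upd: "bnd (z(j := t)) = bnd z" "rest (z(j := t)) = rest z" for z t
    proof -
      have "(\<Sum>i\<in>V. f i * (z(j := t)) i) = (\<Sum>i\<in>V. f i * z i)" for f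
        using assms(2) by (intro sum.cong) auto
      then show "bnd (z(j := t)) = bnd z" "rest (z(j := t)) = rest z"
        by (auto simp: bnd_def rest_def fun_eq_iff)
    qed
    show ?thesis unfolding L R
    proof (intro iffI; elim exE conjE)
      fix z assume "rest z" "\<forall>c\<in>A. z j \<le> bnd z c" "\<forall>c\<in>B. bnd z c \<le> z j"
      then show "\<exists>z. rest z \<and> (\<forall>c\<in>A. \<forall>c'\<in>B. bnd z c' \<le> bnd z c)"
        by (intro exI[of _ z]) force
    next
      fix z assume z: "rest z" "\<forall>c\<in>A. \<forall>c'\<in>B. bnd z c' \<le> bnd z c"
      have "finite A" "finite B" unfolding A B by (auto intro: finite_subset[OF _ assms(3)])
      then obtain t where "\<forall>l\<in>bnd z ` B. l \<le> t" "\<forall>u\<in>bnd z ` A. t \<le> u"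
        using ex_between[of "bnd z ` B" "bnd z ` A"] z by auto
      then show "\<exists>z. rest z \<and> (\<forall>c\<in>A. z j \<le> bnd z c) \<and> (\<forall>c\<in>B. bnd z c \<le> z j)"
        using z by (intro exI[of _ "z(j := t)"]) (simp add: upd)
    qed
  qed
  then show ?thesis by (simp add: feasible_def)
qed

text \<open>The optimum of a linear program is piecewise rational if its coefficients are: elimination of one
  unknown takes finitely many field operations once the signs of its coefficients are known, and there are
  only finitely many sign patterns.\<close>
lemma piecewise_rational_Sup_feasible:
  fixes C :: "(('j \<Rightarrow> 'x \<Rightarrow> real) \<times> ('x \<Rightarrow> real) \<times> ('x \<Rightarrow> real)) set"
  assumes "finite V" "finite C"
    and C: "\<And>a p q. (a, p, q) \<in> C \<Longrightarrow>
       (\<forall>j\<in>V. piecewise_rational X (a j)) \<and> piecewise_rational X p \<and> piecewise_rational X q"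
    and h: "\<And>x. x \<in> X \<Longrightarrow> feasible V C x \<noteq> {} \<and> bdd_above (feasible V C x) \<and>
                        h x = Sup (feasible V C x)"
  shows "piecewise_rational X h"
  using assms
proof (induction V arbitrary: X C rule: finite_induct)
  case empty
  show ?case
    by (rule piecewise_rational_Sup_feasible_base[OF empty.prems(1)])
      (use empty.prems(2) in blast, rule empty.prems(3))
next
  case (insert j V)
  \<comment> \<open>The next elimination step depends on \<open>x\<close> only through the signs of the coefficients of
    the unknown \<open>j\<close>.\<close>
  define Y where "Y = (\<lambda>(A, B). {x \<in> X. A = {(a, p, q) \<in> C. a j x > 0} \<and> B = {(a, p, q) \<in> C. a j x < 0}})"
  have "piecewise_rational (\<Union>AB\<in>Pow C \<times> Pow C. Y AB) h"
  proof (rule piecewise_rational_UN)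
    show "finite (Pow C \<times> Pow C)" using insert.prems(1) by simp
    fix AB assume "AB \<in> Pow C \<times> Pow C"
    then obtain A B where AB: "AB = (A, B)" "A \<subseteq> C" "B \<subseteq> C" by auto
    define C' where "C' = (C - A - B) \<union> (\<lambda>(c, c'). combine j c c') ` (A \<times> B)"
    have YX: "Y AB \<subseteq> X" by (auto simp: Y_def AB)
    have pr: "(\<forall>i\<in>insert j V. piecewise_rational (Y AB) (a i)) \<and> piecewise_rational (Y AB) p \<and>
        piecewise_rational (Y AB) q" if "(a, p, q) \<in> C" for a p q
      using insert.prems(2)[OF that] piecewise_rational_subset[OF _ YX] by blast
    show "piecewise_rational (Y AB) h"
    proof (rule insert.IH)
      have "finite A" "finite B" using AB insert.prems(1) by (auto dest: finite_subset)
      then show "finite C'" unfolding C'_def using insert.prems(1) by simp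
      show "(\<forall>i\<in>V. piecewise_rational (Y AB) (a i)) \<and> piecewise_rational (Y AB) p \<and>
        piecewise_rational (Y AB) q" if "(a, p, q) \<in> C'" for a p q
        using that unfolding C'_def
      proof (elim UnE)
        assume "(a, p, q) \<in> C - A - B"
        then show ?thesis using pr by blast
      next
        assume "(a, p, q) \<in> (\<lambda>(c, c'). combine j c c') ` (A \<times> B)"
        then obtain c c' where cc: "c \<in> A" "c' \<in> B" "(a, p, q) = combine j c c'"
          by (elim imageE SigmaE) simp
        then have c: "c \<in> C" "c' \<in> C" "(a, p, q) = combine j c c'" using AB(2,3) by auto
        obtain a1 p1 q1 a2 p2 q2 where e: "c = (a1, p1, q1)" "c' = (a2, p2, q2)"
          by (cases c, cases c') auto
        show ?thesis
          using c pr[of a1 p1 q1] pr[of a2 p2 q2] unfolding e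
          by (auto simp: combine_def intro!: piecewise_rational_diff piecewise_rational_divide)
      qed
      fix x assume x: "x \<in> Y AB"
      then have "feasible (insert j V) C x = feasible V C' x"
        unfolding C'_def using insert.hyps insert.prems(1)
        by (intro feasible_eliminate) (auto simp: Y_def AB)
      then show "feasible V C' x \<noteq> {} \<and> bdd_above (feasible V C' x) \<and> h x = Sup (feasible V C' x)"
        using insert.prems(3)[of x] x YX by auto
    qed
  qed
  moreover have "X \<subseteq> (\<Union>AB\<in>Pow C \<times> Pow C. Y AB)"
  proof
    fix x assume "x \<in> X"
    then have "x \<in> Y ({(a, p, q) \<in> C. a j x > 0}, {(a, p, q) \<in> C. a j x < 0})"
      by (simp add: Y_def)
    then show "x \<in> (\<Union>AB\<in>Pow C \<times> Pow C. Y AB)" by (rule UN_I[rotated]) auto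
  qed
  ultimately show ?case by (rule piecewise_rational_subset)
qed

end

section \<open>The value of a matrix game\<close>

text \<open>The payoffs that the row player can secure with a mixed action \<open>z\<close>. The value of the matrix game is
  their supremum, which matches the order of supremum and infimum in the discounted value.\<close>
definition guaranteed :: "nat \<Rightarrow> nat \<Rightarrow> (nat \<Rightarrow> nat \<Rightarrow> real) \<Rightarrow> real set" where
  "guaranteed m n A = {v. \<exists>z. (\<forall>a\<in>{1..m}. 0 \<le> z a) \<and> (\<Sum>a\<in>{1..m}. z a) = 1 \<and>
                              (\<forall>b\<in>{1..n}. v \<le> (\<Sum>a\<in>{1..m}. z a * A a b))}"

definition matrix_value :: "nat \<Rightarrow> nat \<Rightarrow> (nat \<Rightarrow> nat \<Rightarrow> real) \<Rightarrow> real" where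
  "matrix_value m n A = Sup (guaranteed m n A)"

lemma lower_bound_guaranteed:
  assumes "m \<ge> 1" "\<And>b. b \<in> {1..n} \<Longrightarrow> C \<le> A 1 b"
  shows "C \<in> guaranteed m n A"
proof -
  have "(\<Sum>a\<in>{1..m}. of_bool (a = 1) * f a) = f 1" for f :: "nat \<Rightarrow> real"
    using assms(1) by (subst sum.remove[of _ 1]) auto
  from this[of "\<lambda>_. 1"] this show ?thesis
    using assms(2) by (auto simp: guaranteed_def intro!: exI[of _ "\<lambda>a. of_bool (a = 1)"])
qed

lemma guaranteed_le:
  assumes "n \<ge> 1" "\<And>a. a \<in> {1..m} \<Longrightarrow> A a 1 \<le> C" "v \<in> guaranteed m n A"
  shows "v \<le> C"
proof -
  obtain z where z: "\<forall>a\<in>{1..m}. 0 \<le> z a" "(\<Sum>a\<in>{1..m}. z a) = 1"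
      "v \<le> (\<Sum>a\<in>{1..m}. z a * A a 1)"
    using assms(1,3) by (fastforce simp: guaranteed_def)
  note z(3)
  also have "(\<Sum>a\<in>{1..m}. z a * A a 1) \<le> (\<Sum>a\<in>{1..m}. z a * C)"
    using z(1) assms(2) by (intro sum_mono mult_left_mono) auto
  also have "\<dots> = C" using z(2) by (simp flip: sum_distrib_right)
  finally show ?thesis .
qed

lemma guaranteed_nonempty:
  assumes "m \<ge> 1" shows "guaranteed m n A \<noteq> {}"
proof -
  have "- (\<Sum>b\<in>{1..n}. \<bar>A 1 b\<bar>) \<in> guaranteed m n A"
  proof (rule lower_bound_guaranteed[OF assms])
    fix b assume "b \<in> {1..n}"
    then have "\<bar>A 1 b\<bar> \<le> (\<Sum>b\<in>{1..n}. \<bar>A 1 b\<bar>)" by (intro member_le_sum) auto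
    then show "- (\<Sum>b\<in>{1..n}. \<bar>A 1 b\<bar>) \<le> A 1 b" by linarith
  qed
  then show ?thesis by blast
qed

lemma guaranteed_bdd_above:
  assumes "n \<ge> 1" shows "bdd_above (guaranteed m n A)"
proof (rule bdd_aboveI)
  fix v assume v: "v \<in> guaranteed m n A"
  show "v \<le> (\<Sum>a\<in>{1..m}. \<bar>A a 1\<bar>)"
  proof (rule guaranteed_le[OF assms _ v])
    fix a assume "a \<in> {1..m}"
    then have "\<bar>A a 1\<bar> \<le> (\<Sum>a\<in>{1..m}. \<bar>A a 1\<bar>)" by (intro member_le_sum) auto
    then show "A a 1 \<le> (\<Sum>a\<in>{1..m}. \<bar>A a 1\<bar>)" by linarith
  qed
qed

lemma abs_matrix_value_le:
  assumes "m \<ge> 1" "n \<ge> 1" "\<And>a b. a \<in> {1..m} \<Longrightarrow> b \<in> {1..n} \<Longrightarrow> \<bar>A a b\<bar> \<le> C"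
  shows "\<bar>matrix_value m n A\<bar> \<le> C"
proof -
  have "v \<le> C" if "v \<in> guaranteed m n A" for v
    using that assms(2,3) by (intro guaranteed_le[of n m A C v]) (auto simp: abs_le_iff)
  then have "matrix_value m n A \<le> C"
    unfolding matrix_value_def by (intro cSup_least guaranteed_nonempty assms)
  moreover have "- C \<in> guaranteed m n A"
  proof (rule lower_bound_guaranteed[OF assms(1)])
    fix b assume "b \<in> {1..n}"
    then have "\<bar>A 1 b\<bar> \<le> C" using assms(1) by (intro assms(3)) auto
    then show "- C \<le> A 1 b" by linarith
  qed
  then have "- C \<le> matrix_value m n A"
    unfolding matrix_value_def by (intro cSup_upper guaranteed_bdd_above assms)
  ultimately show ?thesis by linarith
qed

text \<open>Monotonicity and translation invariance in one: the source of the contraction property of the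
  Shapley operator.\<close>
lemma matrix_value_shift_mono:
  assumes "m \<ge> 1" "n \<ge> 1"
    and le: "\<And>a b. a \<in> {1..m} \<Longrightarrow> b \<in> {1..n} \<Longrightarrow> A a b \<le> A' a b + \<delta>"
  shows "matrix_value m n A \<le> matrix_value m n A' + \<delta>"
  unfolding matrix_value_def
proof (rule cSup_least[OF guaranteed_nonempty[OF assms(1)]])
  fix v assume "v \<in> guaranteed m n A"
  then obtain z where z: "\<forall>a\<in>{1..m}. 0 \<le> z a" "(\<Sum>a\<in>{1..m}. z a) = 1"
      "\<forall>b\<in>{1..n}. v \<le> (\<Sum>a\<in>{1..m}. z a * A a b)"
    by (auto simp: guaranteed_def)
  have "v - \<delta> \<in> guaranteed m n A'"
    unfolding guaranteed_def
  proof (intro CollectI exI[of _ z] conjI z(1,2) ballI)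
    fix b assume b: "b \<in> {1..n}"
    have "v \<le> (\<Sum>a\<in>{1..m}. z a * A a b)" using z(3) b by blast
    also have "\<dots> \<le> (\<Sum>a\<in>{1..m}. z a * (A' a b + \<delta>))"
      using z(1) le b by (intro sum_mono mult_left_mono) auto
    also have "\<dots> = (\<Sum>a\<in>{1..m}. z a * A' a b) + \<delta>"
      using z(2) by (simp add: distrib_left sum.distrib flip: sum_distrib_right)
    finally show "v - \<delta> \<le> (\<Sum>a\<in>{1..m}. z a * A' a b)" by simp
  qed
  then have "v - \<delta> \<le> Sup (guaranteed m n A')"
    by (intro cSup_upper guaranteed_bdd_above assms)
  then show "v \<le> Sup (guaranteed m n A') + \<delta>" by simp
qed

lemma near_optimal_mixed_action:
  assumes "m \<ge> 1" "e > 0"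
  shows "\<exists>p. set_pmf p \<subseteq> {1..m} \<and>
    (\<forall>b\<in>{1..n}. matrix_value m n A - e \<le> (\<Sum>a\<in>{1..m}. pmf p a * A a b))"
proof -
  have "\<exists>v\<in>guaranteed m n A. matrix_value m n A - e < v"
    unfolding matrix_value_def
    by (rule less_cSupE[OF _ guaranteed_nonempty[OF assms(1)]]) (use assms(2) in auto)
  then obtain v z where v: "matrix_value m n A - e < v" and z: "\<forall>a\<in>{1..m}. 0 \<le> z a"
      "(\<Sum>a\<in>{1..m}. z a) = 1" "\<forall>b\<in>{1..n}. v \<le> (\<Sum>a\<in>{1..m}. z a * A a b)"
    by (auto simp: guaranteed_def)
  define f where "f a = (if a \<in> {1..m} then z a else 0)" for a
  have nn: "f a \<ge> 0" for a using z(1) by (simp add: f_def)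
  have "(\<integral>\<^sup>+a. ennreal (f a) \<partial>count_space UNIV) = (\<Sum>a\<in>{1..m}. ennreal (f a))"
    by (rule nn_integral_count_space') (auto simp: f_def)
  also have "\<dots> = ennreal (\<Sum>a\<in>{1..m}. f a)" using nn by (intro sum_ennreal) auto
  also have "(\<Sum>a\<in>{1..m}. f a) = 1" using z(2) by (simp add: f_def)
  finally have int: "(\<integral>\<^sup>+a. ennreal (f a) \<partial>count_space UNIV) = 1" by simp
  have p: "pmf (embed_pmf f) a = f a" for a by (rule pmf_embed_pmf[OF nn int])
  show ?thesis
  proof (intro exI[of _ "embed_pmf f"] conjI ballI)
    show "set_pmf (embed_pmf f) \<subseteq> {1..m}" by (auto simp: set_pmf_eq p f_def)
    fix b assume "b \<in> {1..n}"
    then show "matrix_value m n A - e \<le> (\<Sum>a\<in>{1..m}. pmf (embed_pmf f) a * A a b)"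
      using z(3) v unfolding p by (force simp: f_def)
  qed
qed

text \<open>A mixed action secures at most the value, so some pure reply holds it down to the value.\<close>
lemma ex_good_reply:
  assumes "n \<ge> 1" "set_pmf p \<subseteq> {1..m}"
  shows "\<exists>b\<in>{1..n}. (\<Sum>a\<in>{1..m}. pmf p a * A a b) \<le> matrix_value m n A"
proof (rule ccontr)
  assume neg: "\<not> ?thesis"
  define F where "F b = (\<Sum>a\<in>{1..m}. pmf p a * A a b)" for b
  have fin: "finite (F ` {1..n})" "F ` {1..n} \<noteq> {}" using assms(1) by auto
  have "Min (F ` {1..n}) \<in> guaranteed m n A"
    unfolding guaranteed_def
  proof (intro CollectI exI[of _ "pmf p"] conjI ballI)
    show "(\<Sum>a\<in>{1..m}. pmf p a) = 1" using assms(2) by (intro sum_pmf_eq_1) auto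
    fix b assume "b \<in> {1..n}"
    then show "Min (F ` {1..n}) \<le> (\<Sum>a\<in>{1..m}. pmf p a * A a b)"
      unfolding F_def[symmetric] by (intro Min_le) auto
  qed simp
  then have "Min (F ` {1..n}) \<le> matrix_value m n A"
    unfolding matrix_value_def by (intro cSup_upper guaranteed_bdd_above assms)
  moreover have "matrix_value m n A < Min (F ` {1..n})"
    using fin neg by (subst Min_gr_iff) (auto simp: F_def not_le)
  ultimately show False by simp
qed

section \<open>The Shapley operator and its perturbed fixed points\<close>

definition stage_game ::
  "('s::finite) stochastic_game \<Rightarrow> real \<Rightarrow> ('s \<Rightarrow> real) \<Rightarrow> 's \<Rightarrow> nat \<Rightarrow> nat \<Rightarrow> real" where
  "stage_game G \<beta> u s a b =
     (1 - \<beta>) * reward G s a b + \<beta> * (\<Sum>s'\<in>UNIV. pmf (trans G s a b) s' * u s')"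

definition shapley :: "('s::finite) stochastic_game \<Rightarrow> real \<Rightarrow> ('s \<Rightarrow> real) \<Rightarrow> 's \<Rightarrow> real" where
  "shapley G \<beta> u s = matrix_value (actsI G s) (actsII G s) (stage_game G \<beta> u s)"

lemma stage_game_shift_mono:
  assumes "0 \<le> \<beta>" "\<And>s. u s \<le> u' s + \<delta>"
  shows "stage_game G \<beta> u s a b \<le> stage_game G \<beta> u' s a b + \<beta> * \<delta>"
proof -
  have "(\<Sum>s'\<in>UNIV. pmf (trans G s a b) s' * u s') \<le>
        (\<Sum>s'\<in>UNIV. pmf (trans G s a b) s' * (u' s' + \<delta>))"
    using assms(2) by (intro sum_mono mult_left_mono) auto
  also have "\<dots> = (\<Sum>s'\<in>UNIV. pmf (trans G s a b) s' * u' s') + \<delta>"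
    by (simp add: distrib_left sum.distrib sum_pmf_eq_1 flip: sum_distrib_right)
  finally have "\<beta> * (\<Sum>s'\<in>UNIV. pmf (trans G s a b) s' * u s') \<le>
      \<beta> * ((\<Sum>s'\<in>UNIV. pmf (trans G s a b) s' * u' s') + \<delta>)"
    using assms(1) by (rule mult_left_mono)
  then show ?thesis by (simp add: stage_game_def distrib_left)
qed

lemma shapley_shift_mono:
  assumes "stochastic_game G" "0 \<le> \<beta>" "\<And>s. u s \<le> u' s + \<delta>"
  shows "shapley G \<beta> u s \<le> shapley G \<beta> u' s + \<beta> * \<delta>"
  unfolding shapley_def using assms(1)
  by (intro matrix_value_shift_mono stage_game_shift_mono assms) (auto simp: stochastic_game_def)

lemma obtain_reward_bound:
  fixes G :: "('s::finite) stochastic_game"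
  obtains R where "R \<ge> 0"
    "\<And>s a b. a \<in> {1..actsI G s} \<Longrightarrow> b \<in> {1..actsII G s} \<Longrightarrow> \<bar>reward G s a b\<bar> \<le> R"
proof
  define R where "R = (\<Sum>(s, a, b)\<in>(SIGMA s:UNIV. {1..actsI G s} \<times> {1..actsII G s}). \<bar>reward G s a b\<bar>)"
  show "R \<ge> 0" unfolding R_def by (intro sum_nonneg) auto
  fix s a b assume "a \<in> {1..actsI G s}" "b \<in> {1..actsII G s}"
  then show "\<bar>reward G s a b\<bar> \<le> R" unfolding R_def
    using member_le_sum[of "(s, a, b)" "SIGMA s:UNIV. {1..actsI G s} \<times> {1..actsII G s}"
        "\<lambda>(s, a, b). \<bar>reward G s a b\<bar>"] by auto
qed

lemma abs_stage_game_le: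
  assumes "0 \<le> \<beta>" "\<beta> \<le> 1" "\<bar>reward G s a b\<bar> \<le> R" "\<And>s. \<bar>u s\<bar> \<le> C"
  shows "\<bar>stage_game G \<beta> u s a b\<bar> \<le> (1 - \<beta>) * R + \<beta> * C"
proof -
  have "\<bar>\<Sum>s'\<in>UNIV. pmf (trans G s a b) s' * u s'\<bar> \<le> (\<Sum>s'\<in>UNIV. pmf (trans G s a b) s' * C)"
    using assms(4) by (intro order_trans[OF sum_abs] sum_mono) (auto simp: abs_mult intro: mult_left_mono)
  also have "\<dots> = C" by (simp add: sum_pmf_eq_1 flip: sum_distrib_right)
  finally have "\<beta> * \<bar>\<Sum>s'\<in>UNIV. pmf (trans G s a b) s' * u s'\<bar> \<le> \<beta> * C"
    using assms(1) by (rule mult_left_mono)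
  moreover have "(1 - \<beta>) * \<bar>reward G s a b\<bar> \<le> (1 - \<beta>) * R"
    using assms by (intro mult_left_mono) auto
  moreover have "\<bar>stage_game G \<beta> u s a b\<bar> \<le> (1 - \<beta>) * \<bar>reward G s a b\<bar> +
      \<beta> * \<bar>\<Sum>s'\<in>UNIV. pmf (trans G s a b) s' * u s'\<bar>"
    unfolding stage_game_def using assms(1,2)
    by (intro order_trans[OF abs_triangle_ineq]) (simp add: abs_mult)
  ultimately show ?thesis by linarith
qed

text \<open>Brouwer's theorem on a cube. The half side \<open>C\<close> solves \<open>W + (1 - \<beta>) * R + \<beta> * C = C\<close>, where \<open>R\<close> bounds
  the rewards and \<open>W\<close> the perturbation, so that the cube is mapped into itself.\<close>
lemma perturbed_shapley_fixpoint_exists: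
  fixes G :: "('s::finite) stochastic_game"
  assumes G: "stochastic_game G" and \<beta>: "0 \<le> \<beta>" "\<beta> < 1"
  shows "\<exists>u. \<forall>s. u s = w s + shapley G \<beta> u s"
proof -
  obtain R where R: "R \<ge> 0" "\<And>s a b. a \<in> {1..actsI G s} \<Longrightarrow> b \<in> {1..actsII G s} \<Longrightarrow>
      \<bar>reward G s a b\<bar> \<le> R"
    using obtain_reward_bound by blast
  define W where "W = (\<Sum>s\<in>UNIV. \<bar>w s\<bar>)"
  have W: "\<bar>w s\<bar> \<le> W" "W \<ge> 0" for s
    unfolding W_def by (intro member_le_sum) (auto intro: sum_nonneg)
  define C where "C = R + W / (1 - \<beta>)"
  have C: "W + ((1 - \<beta>) * R + \<beta> * C) = C" using \<beta> by (simp add: C_def field_simps)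
  have "C \<ge> 0" using R(1) W(2) \<beta> by (simp add: C_def)
  define f :: "real ^ 's \<Rightarrow> real ^ 's" where "f x = (\<chi> s. w s + shapley G \<beta> (($) x) s)" for x
  define S :: "(real ^ 's) set" where "S = cbox (\<chi> s. - C) (\<chi> s. C)"
  have S: "x \<in> S \<longleftrightarrow> (\<forall>s. \<bar>x $ s\<bar> \<le> C)" for x
    by (auto simp: S_def mem_box_cart abs_le_iff minus_le_iff)
  obtain x where "f x = x"
  proof (rule brouwer[of S f])
    show "compact S" "convex S" by (simp_all add: S_def)
    have "0 \<in> S" using \<open>C \<ge> 0\<close> by (simp add: S)
    then show "S \<noteq> {}" by blast
    have "continuous_on S (\<lambda>x. w s + shapley G \<beta> (($) x) s)" for s
    proof (intro continuous_intros lipschitz_on_continuous_on[of \<beta>] lipschitz_onI)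
      fix x y :: "real ^ 's"
      have "x $ s \<le> y $ s + norm (x - y)" "y $ s \<le> x $ s + norm (x - y)" for s
        using component_le_norm_cart[of "x - y" s] by auto
      then have "shapley G \<beta> (($) x) s \<le> shapley G \<beta> (($) y) s + \<beta> * norm (x - y)"
        "shapley G \<beta> (($) y) s \<le> shapley G \<beta> (($) x) s + \<beta> * norm (x - y)"
        using G \<beta> by (auto intro!: shapley_shift_mono)
      then show "dist (shapley G \<beta> (($) x) s) (shapley G \<beta> (($) y) s) \<le> \<beta> * dist x y"
        by (simp add: dist_norm abs_le_iff)
    qed (use \<beta> in auto)
    then show "continuous_on S f" unfolding f_def by (intro continuous_on_vec_lambda)
    show "f \<in> S \<rightarrow> S"
    proof (intro funcsetI)
      fix x assume "x \<in> S"
      then have "\<bar>stage_game G \<beta> (($) x) s a b\<bar> \<le> (1 - \<beta>) * R + \<beta> * C"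
        if "a \<in> {1..actsI G s}" "b \<in> {1..actsII G s}" for s a b
        using that \<beta> by (intro abs_stage_game_le R) (auto simp: S)
      then have "\<bar>shapley G \<beta> (($) x) s\<bar> \<le> (1 - \<beta>) * R + \<beta> * C" for s
        unfolding shapley_def using G by (intro abs_matrix_value_le) (auto simp: stochastic_game_def)
      then have "\<bar>w s + shapley G \<beta> (($) x) s\<bar> \<le> W + ((1 - \<beta>) * R + \<beta> * C)" for s
        using W(1) by (intro order_trans[OF abs_triangle_ineq] add_mono) auto
      then show "f x \<in> S" unfolding C by (simp add: S f_def)
    qed
  qed
  then show ?thesis by (intro exI[of _ "($) x"]) (simp add: f_def vec_eq_iff)
qed

lemma shapley_fixpoint_stable:
  fixes G :: "('s::finite) stochastic_game"
  assumes G: "stochastic_game G" and \<beta>: "0 \<le> \<beta>" "\<beta> < 1"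
    and u: "\<And>s. u s = w s + shapley G \<beta> u s" and v: "\<And>s. v s = shapley G \<beta> v s"
    and w: "\<And>s. \<bar>w s\<bar> \<le> \<delta>"
  shows "\<bar>u s - v s\<bar> \<le> \<delta> / (1 - \<beta>)"
proof -
  define M where "M = Max (range (\<lambda>s. \<bar>u s - v s\<bar>))"
  have M: "\<bar>u s - v s\<bar> \<le> M" for s unfolding M_def by (intro Max_ge) auto
  have "u s \<le> v s + M" "v s \<le> u s + M" for s using M[of s] by auto
  then have "shapley G \<beta> u s \<le> shapley G \<beta> v s + \<beta> * M"
      "shapley G \<beta> v s \<le> shapley G \<beta> u s + \<beta> * M" for s
    using G \<beta> by (auto intro!: shapley_shift_mono)
  then have le: "\<bar>u s - v s\<bar> \<le> \<delta> + \<beta> * M" for s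
    using u[of s] v[of s] w[of s] by (smt (verit))
  have "M \<in> range (\<lambda>s. \<bar>u s - v s\<bar>)" unfolding M_def by (intro Max_in) auto
  then have "M \<le> \<delta> + \<beta> * M" using le by auto
  then have "M \<le> \<delta> / (1 - \<beta>)" using \<beta> by (simp add: field_simps)
  with M[of s] show ?thesis by linarith
qed

section \<open>The discounted value is the fixed point of the Shapley operator\<close>

lemma finite_set_pmf_play:
  fixes G :: "('s::finite) stochastic_game"
  assumes "\<mu> \<in> strategiesI G" "\<nu> \<in> strategiesII G"
  shows "finite (set_pmf (play G \<mu> \<nu> t s))"
proof (induction t arbitrary: s)
  case (Suc t)
  have "set_pmf (\<mu> s) \<subseteq> {1..actsI G s}" "set_pmf (\<nu> s) \<subseteq> {1..actsII G s}"
    using assms by (auto simp: strategiesI_def strategiesII_def)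
  then have "finite (set_pmf (\<mu> s))" "finite (set_pmf (\<nu> s))"
    by (auto dest: finite_subset)
  with Suc show ?case by (auto simp: set_bind_pmf)
qed simp

text \<open>Conditioning on the first stage.\<close>
lemma expectation_play_Suc:
  fixes G :: "('s::finite) stochastic_game" and f :: "_ \<Rightarrow> real"
  assumes "\<mu> \<in> strategiesI G" "\<nu> \<in> strategiesII G"
  shows "measure_pmf.expectation (play G \<mu> \<nu> (Suc t) s) f =
    (\<Sum>a\<in>{1..actsI G s}. \<Sum>b\<in>{1..actsII G s}. pmf (\<mu> s) a * pmf (\<nu> s) b *
      (\<Sum>s'\<in>UNIV. pmf (trans G s a b) s' *
         measure_pmf.expectation (play G \<mu> \<nu> t s') (\<lambda>h. f ((s, a, b) # h))))"
proof -
  have sub: "set_pmf (\<mu> s) \<subseteq> {1..actsI G s}" "set_pmf (\<nu> s) \<subseteq> {1..actsII G s}"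
    using assms by (auto simp: strategiesI_def strategiesII_def)
  have fin: "finite (set_pmf (\<nu> s))" by (rule finite_subset[OF sub(2)]) simp
  note fp = finite_set_pmf_play[OF assms]
  show ?thesis
    by (simp add: pmf_expectation_bind[OF _ _ sub(1)] pmf_expectation_bind[OF _ _ sub(2)]
        pmf_expectation_bind[of UNIV] fin fp set_bind_pmf sum_distrib_left mult.assoc)
qed

lemma expected_stage_payoff_first:
  fixes G :: "('s::finite) stochastic_game"
  assumes "\<mu> \<in> strategiesI G" "\<nu> \<in> strategiesII G"
  shows "expected_stage_payoff G \<mu> \<nu> s (Suc 0) =
    (\<Sum>a\<in>{1..actsI G s}. \<Sum>b\<in>{1..actsII G s}. pmf (\<mu> s) a * pmf (\<nu> s) b * reward G s a b)"
  unfolding expected_stage_payoff_def expectation_play_Suc[OF assms]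
  by (simp add: stage_payoff_def sum_pmf_eq_1 flip: sum_distrib_right)

lemma expected_stage_payoff_later:
  fixes G :: "('s::finite) stochastic_game"
  assumes "\<mu> \<in> strategiesI G" "\<nu> \<in> strategiesII G"
  shows "expected_stage_payoff G \<mu> \<nu> s (Suc (Suc k)) =
    (\<Sum>a\<in>{1..actsI G s}. \<Sum>b\<in>{1..actsII G s}. pmf (\<mu> s) a * pmf (\<nu> s) b *
      (\<Sum>s'\<in>UNIV. pmf (trans G s a b) s' * expected_stage_payoff G \<mu> \<nu> s' (Suc k)))"
proof -
  have "stage_payoff G (Suc (Suc k)) (x # h) = stage_payoff G (Suc k) h" for x h
    by (simp add: stage_payoff_def)
  then show ?thesis
    unfolding expected_stage_payoff_def expectation_play_Suc[OF assms, of "Suc k"] by simp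
qed

definition one_stage_payoff ::
  "('s::finite) stochastic_game \<Rightarrow> real \<Rightarrow> ('s \<Rightarrow> nat pmf) \<Rightarrow> ('s \<Rightarrow> nat pmf) \<Rightarrow> ('s \<Rightarrow> real) \<Rightarrow> 's \<Rightarrow> real"
where
  "one_stage_payoff G \<beta> \<mu> \<nu> V s = (\<Sum>a\<in>{1..actsI G s}. \<Sum>b\<in>{1..actsII G s}.
     pmf (\<mu> s) a * pmf (\<nu> s) b * stage_game G \<beta> V s a b)"

lemma sum_strategies_eq_1:
  assumes "\<mu> \<in> strategiesI G" "\<nu> \<in> strategiesII G"
  shows "(\<Sum>a\<in>{1..actsI G s}. \<Sum>b\<in>{1..actsII G s}. pmf (\<mu> s) a * pmf (\<nu> s) b) = 1"
proof -
  have "(\<Sum>a\<in>{1..actsI G s}. pmf (\<mu> s) a) = 1" "(\<Sum>b\<in>{1..actsII G s}. pmf (\<nu> s) b) = 1"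
    using assms by (auto simp: strategiesI_def strategiesII_def intro!: sum_pmf_eq_1)
  then show ?thesis by (simp flip: sum_distrib_left)
qed

lemma abs_average_le:
  assumes "\<mu> \<in> strategiesI G" "\<nu> \<in> strategiesII G"
    and "\<And>a b. a \<in> {1..actsI G s} \<Longrightarrow> b \<in> {1..actsII G s} \<Longrightarrow> \<bar>F a b\<bar> \<le> C"
  shows "\<bar>\<Sum>a\<in>{1..actsI G s}. \<Sum>b\<in>{1..actsII G s}. pmf (\<mu> s) a * pmf (\<nu> s) b * F a b\<bar> \<le> C"
proof -
  have "\<bar>\<Sum>a\<in>{1..actsI G s}. \<Sum>b\<in>{1..actsII G s}. pmf (\<mu> s) a * pmf (\<nu> s) b * F a b\<bar> \<le>
      (\<Sum>a\<in>{1..actsI G s}. \<Sum>b\<in>{1..actsII G s}. pmf (\<mu> s) a * pmf (\<nu> s) b * C)"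
    using assms(3) by (intro order_trans[OF sum_abs] sum_mono)
      (auto simp: abs_mult intro!: mult_left_mono)
  also have "\<dots> = C" using sum_strategies_eq_1[OF assms(1,2)] by (simp flip: sum_distrib_right)
  finally show ?thesis .
qed

lemma abs_expected_stage_payoff_le:
  fixes G :: "('s::finite) stochastic_game"
  assumes st: "\<mu> \<in> strategiesI G" "\<nu> \<in> strategiesII G"
    and R: "\<And>s a b. a \<in> {1..actsI G s} \<Longrightarrow> b \<in> {1..actsII G s} \<Longrightarrow> \<bar>reward G s a b\<bar> \<le> R"
  shows "\<bar>expected_stage_payoff G \<mu> \<nu> s (Suc k)\<bar> \<le> R"
proof (induction k arbitrary: s)
  case 0
  show ?case unfolding expected_stage_payoff_first[OF st] by (rule abs_average_le[OF st R])
next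
  case (Suc k)
  have "\<bar>\<Sum>s'\<in>UNIV. pmf (trans G s a b) s' * expected_stage_payoff G \<mu> \<nu> s' (Suc k)\<bar> \<le>
      (\<Sum>s'\<in>UNIV. pmf (trans G s a b) s' * R)" for a b
    using Suc by (intro order_trans[OF sum_abs] sum_mono) (auto simp: abs_mult intro: mult_left_mono)
  then show ?case unfolding expected_stage_payoff_later[OF st]
    by (intro abs_average_le[OF st]) (simp add: sum_pmf_eq_1 flip: sum_distrib_right)
qed

context
  fixes G :: "('s::finite) stochastic_game" and \<mu> \<nu> and \<beta> :: real
  assumes \<beta>: "0 < \<beta>" "\<beta> < 1"
    and st: "\<mu> \<in> strategiesI G" "\<nu> \<in> strategiesII G"
begin

lemma
  assumes R: "\<And>s a b. a \<in> {1..actsI G s} \<Longrightarrow> b \<in> {1..actsII G s} \<Longrightarrow> \<bar>reward G s a b\<bar> \<le> R"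
  shows discounted_payoff_sums: "(\<lambda>k. \<beta> ^ k * (1 - \<beta>) * expected_stage_payoff G \<mu> \<nu> s (Suc k))
      sums discounted_payoff G \<beta> \<mu> \<nu> s"
    and abs_discounted_payoff_le: "\<bar>discounted_payoff G \<beta> \<mu> \<nu> s\<bar> \<le> R"
proof -
  define f where "f k = \<beta> ^ k * (1 - \<beta>) * expected_stage_payoff G \<mu> \<nu> s (Suc k)" for k
  have g: "(\<lambda>k. \<beta> ^ k * ((1 - \<beta>) * R)) sums R"
    using sums_mult2[OF geometric_sums[of \<beta>], of "(1 - \<beta>) * R"] \<beta> by simp
  have le: "norm (f k) \<le> \<beta> ^ k * ((1 - \<beta>) * R)" for k
    using abs_expected_stage_payoff_le[OF st R, of s k] \<beta>
    by (auto simp: f_def abs_mult mult.assoc intro!: mult_left_mono)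
  have s: "summable f" by (rule summable_comparison_test'[OF sums_summable[OF g] le])
  have "norm (\<Sum>k. f k) \<le> (\<Sum>k. \<beta> ^ k * ((1 - \<beta>) * R))"
    by (rule norm_suminf_le[OF le sums_summable[OF g]])
  then show "\<bar>discounted_payoff G \<beta> \<mu> \<nu> s\<bar> \<le> R"
    by (simp add: discounted_payoff_def sums_unique[OF g, symmetric] flip: f_def)
  show "(\<lambda>k. \<beta> ^ k * (1 - \<beta>) * expected_stage_payoff G \<mu> \<nu> s (Suc k))
      sums discounted_payoff G \<beta> \<mu> \<nu> s"
    using summable_sums[OF s] by (simp only: f_def[abs_def] discounted_payoff_def)
qed

lemma discounted_payoff_one_stage:
  "discounted_payoff G \<beta> \<mu> \<nu> s = one_stage_payoff G \<beta> \<mu> \<nu> (discounted_payoff G \<beta> \<mu> \<nu>) s"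
proof -
  define V where "V = discounted_payoff G \<beta> \<mu> \<nu>"
  define E where "E = expected_stage_payoff G \<mu> \<nu>"
  obtain R where "R \<ge> 0" and R: "\<And>s a b. a \<in> {1..actsI G s} \<Longrightarrow> b \<in> {1..actsII G s} \<Longrightarrow>
      \<bar>reward G s a b\<bar> \<le> R"
    using obtain_reward_bound by blast
  have V: "(\<lambda>k. \<beta> ^ k * (1 - \<beta>) * E s (Suc k)) sums V s" for s
    unfolding V_def E_def by (rule discounted_payoff_sums[OF R])
  have "(\<lambda>k. \<Sum>a\<in>{1..actsI G s}. \<Sum>b\<in>{1..actsII G s}. pmf (\<mu> s) a * pmf (\<nu> s) b *
          (\<beta> * (\<Sum>s'\<in>UNIV. pmf (trans G s a b) s' * (\<beta> ^ k * (1 - \<beta>) * E s' (Suc k)))))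
     sums (\<Sum>a\<in>{1..actsI G s}. \<Sum>b\<in>{1..actsII G s}. pmf (\<mu> s) a * pmf (\<nu> s) b *
          (\<beta> * (\<Sum>s'\<in>UNIV. pmf (trans G s a b) s' * V s')))"
    by (intro sums_sum sums_mult V)
  also have "(\<lambda>k. \<Sum>a\<in>{1..actsI G s}. \<Sum>b\<in>{1..actsII G s}. pmf (\<mu> s) a * pmf (\<nu> s) b *
          (\<beta> * (\<Sum>s'\<in>UNIV. pmf (trans G s a b) s' * (\<beta> ^ k * (1 - \<beta>) * E s' (Suc k))))) =
      (\<lambda>k. \<beta> ^ Suc k * (1 - \<beta>) * E s (Suc (Suc k)))"
    unfolding E_def expected_stage_payoff_later[OF st]
    by (simp add: sum_distrib_left mult_ac)
  finally have "(\<lambda>k. \<beta> ^ k * (1 - \<beta>) * E s (Suc k)) sums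
     ((\<Sum>a\<in>{1..actsI G s}. \<Sum>b\<in>{1..actsII G s}. pmf (\<mu> s) a * pmf (\<nu> s) b *
          (\<beta> * (\<Sum>s'\<in>UNIV. pmf (trans G s a b) s' * V s'))) + (1 - \<beta>) * E s (Suc 0))"
    using sums_Suc[of "\<lambda>k. \<beta> ^ k * (1 - \<beta>) * E s (Suc k)"] by simp
  from sums_unique2[OF V this] show ?thesis
    unfolding V_def[symmetric] one_stage_payoff_def stage_game_def
    by (simp add: E_def expected_stage_payoff_first[OF st] sum_distrib_left distrib_left
        sum.distrib mult_ac)
qed

lemma one_stage_shift_mono:
  assumes "\<And>s. u s \<le> u' s + \<delta>"
  shows "one_stage_payoff G \<beta> \<mu> \<nu> u s \<le> one_stage_payoff G \<beta> \<mu> \<nu> u' s + \<beta> * \<delta>"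
proof -
  have "one_stage_payoff G \<beta> \<mu> \<nu> u s \<le> (\<Sum>a\<in>{1..actsI G s}. \<Sum>b\<in>{1..actsII G s}.
     pmf (\<mu> s) a * pmf (\<nu> s) b * (stage_game G \<beta> u' s a b + \<beta> * \<delta>))"
    unfolding one_stage_payoff_def using \<beta> assms
    by (intro sum_mono mult_left_mono stage_game_shift_mono) auto
  also have "\<dots> = one_stage_payoff G \<beta> \<mu> \<nu> u' s + \<beta> * \<delta>"
    using sum_strategies_eq_1[OF st]
    by (simp add: one_stage_payoff_def distrib_left sum.distrib flip: sum_distrib_right)
  finally show ?thesis .
qed

text \<open>A sub-solution of the one-stage equation, up to \<open>e\<close>, lies below a super-solution: the largest difference \<open>M\<close>
  satisfies \<open>M \<le> e + \<beta> * M\<close>. This compares a fixed point of the Shapley operator with the payoff of a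
  given pair of strategies in both directions.\<close>
lemma one_stage_comparison:
  assumes f: "\<And>s. f s \<le> one_stage_payoff G \<beta> \<mu> \<nu> f s + e" and g: "\<And>s. one_stage_payoff G \<beta> \<mu> \<nu> g s \<le> g s"
  shows "f s \<le> g s + e / (1 - \<beta>)"
proof -
  define M where "M = Max (range (\<lambda>s. f s - g s))"
  have M: "f s - g s \<le> M" for s unfolding M_def by (intro Max_ge) auto
  have "f s \<le> g s + M" for s using M[of s] by simp
  then have "one_stage_payoff G \<beta> \<mu> \<nu> f s \<le> one_stage_payoff G \<beta> \<mu> \<nu> g s + \<beta> * M" for s
    by (rule one_stage_shift_mono)
  then have le: "f s - g s \<le> e + \<beta> * M" for s using f[of s] g[of s] by (smt (verit))
  have "M \<in> range (\<lambda>s. f s - g s)" unfolding M_def by (intro Max_in) auto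
  then have "M \<le> e + \<beta> * M" using le by auto
  then have "M \<le> e / (1 - \<beta>)" using \<beta> by (simp add: field_simps)
  with M[of s] show ?thesis by linarith
qed

end

text \<open>For the lower bound, player I uses in each state an almost optimal mixed action of the one-stage game
  with continuation \<open>u\<close>. For the upper bound, player II answers a given stationary strategy by
  pure actions that hold it down to the value of that game in each state.\<close>
lemma discounted_value_eq_fixpoint:
  fixes G :: "('s::finite) stochastic_game"
  assumes G: "stochastic_game G" and \<beta>: "0 < \<beta>" "\<beta> < 1"
    and u: "\<And>s. u s = shapley G \<beta> u s"
  shows "discounted_value G \<beta> s = u s"
proof -
  define V where "V = discounted_payoff G \<beta>"
  obtain R where "R \<ge> 0" and R: "\<And>s a b. a \<in> {1..actsI G s} \<Longrightarrow> b \<in> {1..actsII G s} \<Longrightarrow>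
      \<bar>reward G s a b\<bar> \<le> R"
    using obtain_reward_bound by blast
  have acts: "actsI G s \<ge> 1" "actsII G s \<ge> 1" for s using G by (auto simp: stochastic_game_def)
  have V: "\<bar>V \<mu> \<nu> s\<bar> \<le> R" if "\<mu> \<in> strategiesI G" "\<nu> \<in> strategiesII G" for \<mu> \<nu>
    unfolding V_def by (rule abs_discounted_payoff_le[OF \<beta> that R])
  have neI: "strategiesI G \<noteq> {}" "strategiesII G \<noteq> {}"
  proof -
    have "(\<lambda>_. return_pmf 1) \<in> strategiesI G" "(\<lambda>_. return_pmf 1) \<in> strategiesII G"
      using acts by (auto simp: strategiesI_def strategiesII_def)
    then show "strategiesI G \<noteq> {}" "strategiesII G \<noteq> {}" by blast+
  qed
  have V_bounds: "- R \<le> V \<mu> \<nu> s" "V \<mu> \<nu> s \<le> R"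
    if "\<mu> \<in> strategiesI G" "\<nu> \<in> strategiesII G" for \<mu> \<nu>
    using V[OF that] by auto
  have bdd_V: "bdd_below ((\<lambda>\<nu>. V \<mu> \<nu> s) ` strategiesII G)" if "\<mu> \<in> strategiesI G" for \<mu>
    using V_bounds(1)[OF that] by (intro bdd_belowI2[of _ "- R"])
  obtain \<nu>0 where \<nu>0: "\<nu>0 \<in> strategiesII G" using neI(2) by blast
  have bdd_INF: "bdd_above ((\<lambda>\<mu>. INF \<nu>\<in>strategiesII G. V \<mu> \<nu> s) ` strategiesI G)"
  proof (rule bdd_aboveI2)
    fix \<mu> assume "\<mu> \<in> strategiesI G"
    then show "(INF \<nu>\<in>strategiesII G. V \<mu> \<nu> s) \<le> R"
      using V_bounds(2) \<nu>0 by (intro cINF_lower2[OF bdd_V])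
  qed
  have eq: "one_stage_payoff G \<beta> \<mu> \<nu> u s = (\<Sum>b\<in>{1..actsII G s}. pmf (\<nu> s) b *
      (\<Sum>a\<in>{1..actsI G s}. pmf (\<mu> s) a * stage_game G \<beta> u s a b))" for \<mu> \<nu> s
    unfolding one_stage_payoff_def by (subst sum.swap) (simp add: sum_distrib_left mult_ac)
  have sum_II: "(\<Sum>b\<in>{1..actsII G s}. pmf (\<nu> s) b) = 1" if "\<nu> \<in> strategiesII G" for \<nu> s
    using that by (intro sum_pmf_eq_1) (auto simp: strategiesII_def)
  have "u s \<le> discounted_value G \<beta> s"
  proof (rule field_le_epsilon)
    fix e :: real assume "e > 0"
    define d where "d = e * (1 - \<beta>)"
    have d: "d > 0" using \<open>e > 0\<close> \<beta> by (simp add: d_def)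
    have "\<exists>p. set_pmf p \<subseteq> {1..actsI G s} \<and> (\<forall>b\<in>{1..actsII G s}.
        u s - d \<le> (\<Sum>a\<in>{1..actsI G s}. pmf p a * stage_game G \<beta> u s a b))" for s
      by (subst u, unfold shapley_def) (rule near_optimal_mixed_action[OF acts(1) d])
    then obtain \<mu> where \<mu>: "\<And>s. set_pmf (\<mu> s) \<subseteq> {1..actsI G s}"
        "\<And>s b. b \<in> {1..actsII G s} \<Longrightarrow>
           u s - d \<le> (\<Sum>a\<in>{1..actsI G s}. pmf (\<mu> s) a * stage_game G \<beta> u s a b)"
      by metis
    have \<mu>I: "\<mu> \<in> strategiesI G" using \<mu>(1) by (simp add: strategiesI_def)
    have "u s - e \<le> V \<mu> \<nu> s" if \<nu>: "\<nu> \<in> strategiesII G" for \<nu>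
    proof -
      have "u s \<le> V \<mu> \<nu> s + d / (1 - \<beta>)"
        unfolding V_def
      proof (rule one_stage_comparison[OF \<beta> \<mu>I \<nu>])
        show "one_stage_payoff G \<beta> \<mu> \<nu> (discounted_payoff G \<beta> \<mu> \<nu>) s \<le> discounted_payoff G \<beta> \<mu> \<nu> s" for s
          using discounted_payoff_one_stage[OF \<beta> \<mu>I \<nu>, of s] by simp
        fix s
        have "(\<Sum>b\<in>{1..actsII G s}. pmf (\<nu> s) b * (u s - d)) \<le> one_stage_payoff G \<beta> \<mu> \<nu> u s"
          unfolding eq using \<mu>(2) by (intro sum_mono mult_left_mono) auto
        then show "u s \<le> one_stage_payoff G \<beta> \<mu> \<nu> u s + d"
          unfolding sum_distrib_right[symmetric] sum_II[OF \<nu>] by simp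
      qed
      then show ?thesis using \<beta> by (simp add: d_def)
    qed
    then have "u s - e \<le> (INF \<nu>\<in>strategiesII G. V \<mu> \<nu> s)" by (intro cINF_greatest neI(2))
    also have "\<dots> \<le> discounted_value G \<beta> s"
      unfolding discounted_value_def V_def[symmetric] by (rule cSUP_upper[OF \<mu>I bdd_INF])
    finally show "u s \<le> discounted_value G \<beta> s + e" by simp
  qed
  moreover have "discounted_value G \<beta> s \<le> u s"
    unfolding discounted_value_def V_def[symmetric]
  proof (rule cSUP_least[OF neI(1)])
    fix \<mu> assume \<mu>I: "\<mu> \<in> strategiesI G"
    have "\<exists>b\<in>{1..actsII G s}. (\<Sum>a\<in>{1..actsI G s}. pmf (\<mu> s) a * stage_game G \<beta> u s a b) \<le> u s" for s
    proof -
      have "set_pmf (\<mu> s) \<subseteq> {1..actsI G s}" using \<mu>I by (simp add: strategiesI_def)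
      from ex_good_reply[OF acts(2) this, of s "stage_game G \<beta> u s"] show ?thesis
        by (simp only: u[of s, unfolded shapley_def, symmetric])
    qed
    then obtain b where b: "\<And>s. b s \<in> {1..actsII G s}"
        "\<And>s. (\<Sum>a\<in>{1..actsI G s}. pmf (\<mu> s) a * stage_game G \<beta> u s a (b s)) \<le> u s"
      by metis
    define \<nu> where "\<nu> s = return_pmf (b s)" for s
    have \<nu>: "\<nu> \<in> strategiesII G" using b(1) by (simp add: strategiesII_def \<nu>_def)
    have "V \<mu> \<nu> s \<le> u s + 0 / (1 - \<beta>)"
      unfolding V_def
    proof (rule one_stage_comparison[OF \<beta> \<mu>I \<nu>])
      show "discounted_payoff G \<beta> \<mu> \<nu> s \<le> one_stage_payoff G \<beta> \<mu> \<nu> (discounted_payoff G \<beta> \<mu> \<nu>) s + 0" for s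
        using discounted_payoff_one_stage[OF \<beta> \<mu>I \<nu>, of s] by simp
      fix s
      have "(\<Sum>c\<in>{1..actsII G s}. pmf (\<nu> s) c * F c) = F (b s)" for F
        using b(1)[of s] by (subst sum.remove[of _ "b s"]) (auto simp: \<nu>_def indicator_def)
      then show "one_stage_payoff G \<beta> \<mu> \<nu> u s \<le> u s" unfolding eq using b(2)[of s] by simp
    qed
    then show "(INF \<nu>\<in>strategiesII G. V \<mu> \<nu> s) \<le> u s"
      using \<nu> by (intro cINF_lower2[OF bdd_V[OF \<mu>I]]) auto
  qed
  ultimately show ?thesis by simp
qed

section \<open>Rational linear combinations of real functions\<close>

definition rat_scale :: "rat \<Rightarrow> ('x \<Rightarrow> real) \<Rightarrow> 'x \<Rightarrow> real" where
  "rat_scale q f = (\<lambda>x. of_rat q * f x)"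

interpretation rat_fun: vector_space rat_scale
  by unfold_locales (auto simp: rat_scale_def fun_eq_iff algebra_simps of_rat_add of_rat_mult)

lemma rat_scale_mult_left: "rat_scale q f * g = rat_scale q (f * g)"
  and rat_scale_mult_right: "f * rat_scale q g = rat_scale q (f * g)"
  by (auto simp: rat_scale_def fun_eq_iff)

lemma span_mult:
  assumes "f \<in> rat_fun.span S" "g \<in> rat_fun.span T"
    and "\<And>s t. s \<in> S \<Longrightarrow> t \<in> T \<Longrightarrow> s * t \<in> rat_fun.span U"
  shows "f * g \<in> rat_fun.span U"
  using assms(1)
proof (rule rat_fun.span_induct)
  show "rat_fun.subspace {f. f * g \<in> rat_fun.span U}"
    by (auto simp: rat_fun.subspace_def distrib_right rat_scale_mult_left
        intro: rat_fun.span_zero rat_fun.span_add rat_fun.span_scale)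
  fix s assume s: "s \<in> S"
  show "s * g \<in> rat_fun.span U"
    using assms(2)
  proof (rule rat_fun.span_induct)
    show "rat_fun.subspace {g. s * g \<in> rat_fun.span U}"
      by (auto simp: rat_fun.subspace_def distrib_left rat_scale_mult_right
          intro: rat_fun.span_zero rat_fun.span_add rat_fun.span_scale)
    show "s * t \<in> rat_fun.span U" if "t \<in> T" for t using assms(3)[OF s that] .
  qed
qed

text \<open>Linear dependence of a family, with repetitions allowed: two equal members are dependent.\<close>
lemma ex_rational_relation:
  fixes f :: "'i \<Rightarrow> 'x \<Rightarrow> real"
  assumes "finite T" "finite I" "f ` I \<subseteq> rat_fun.span T" "card T < card I"
  shows "\<exists>c. (\<exists>i\<in>I. c i \<noteq> 0) \<and> (\<forall>x. (\<Sum>i\<in>I. of_rat (c i) * f i x) = 0)"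
proof (cases "inj_on f I")
  case True
  have "rat_fun.dependent (f ` I)"
    using rat_fun.independent_span_bound[OF assms(1) _ assms(3)] assms(4) card_image[OF True]
    by (metis not_le)
  then obtain u where u: "\<exists>v\<in>f ` I. u v \<noteq> 0" "(\<Sum>v\<in>f ` I. rat_scale (u v) v) = 0"
    using rat_fun.dependent_finite[of "f ` I"] assms(2) by auto
  have sum_apply: "(\<Sum>i\<in>A. g i) x = (\<Sum>i\<in>A. g i x)" for A and g :: "'i \<Rightarrow> 'x \<Rightarrow> real" and x
    by (induction A rule: infinite_finite_induct) auto
  have "(\<Sum>i\<in>I. of_rat (u (f i)) * f i x) = 0" for x
  proof -
    have "(\<Sum>i\<in>I. rat_scale (u (f i)) (f i)) = 0"
      using u(2) True by (simp add: sum.reindex)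
    then have "(\<Sum>i\<in>I. rat_scale (u (f i)) (f i)) x = 0" by simp
    then show ?thesis by (simp add: sum_apply rat_scale_def)
  qed
  with u(1) show ?thesis by (intro exI[of _ "\<lambda>i. u (f i)"]) auto
next
  case False
  then obtain i j where ij: "i \<in> I" "j \<in> I" "i \<noteq> j" "f i = f j" by (auto simp: inj_on_def)
  define c :: "'i \<Rightarrow> rat" where "c k = (if k = i then 1 else if k = j then - 1 else 0)" for k
  have "(\<Sum>k\<in>I. of_rat (c k) * f k x) = (\<Sum>k\<in>{i, j}. of_rat (c k) * f k x)" for x
    using ij assms(2) by (intro sum.mono_neutral_right) (auto simp: c_def)
  then have "(\<Sum>k\<in>I. of_rat (c k) * f k x) = 0" for x
    using ij by (simp add: c_def)
  moreover have "c i \<noteq> 0" by (simp add: c_def)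
  ultimately show ?thesis using ij(1) by blast
qed

text \<open>The rational span of \<open>B\<close> is a unital algebra of finite dimension. In the application \<open>B\<close> consists of constant functions, and its span is
  a ring of algebraic numbers that contains the data of the game.\<close>
definition spans_algebra :: "('x \<Rightarrow> real) set \<Rightarrow> bool" where
  "spans_algebra B \<longleftrightarrow> finite B \<and> 1 \<in> rat_fun.span B \<and>
     (\<forall>b\<in>B. \<forall>c\<in>B. b * c \<in> rat_fun.span B)"

lemma algebraic_power_rewrite:
  fixes a :: real
  assumes "algebraic a"
  obtains n and r :: "nat \<Rightarrow> rat" where "a ^ n = (\<Sum>i<n. of_rat (r i) * a ^ i)"
proof -
  have "\<exists>p. (\<forall>i. coeff p i \<in> \<rat>) \<and> p \<noteq> 0 \<and> poly p a = 0"
    using assms by (simp only: algebraic_altdef)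
  then obtain p where p: "\<forall>i. coeff p i \<in> \<rat>" "p \<noteq> 0" "poly p a = 0"
    by (elim exE conjE) (rule that)
  have "\<forall>i. \<exists>q. coeff p i = of_rat q"
  proof
    fix i show "\<exists>q. coeff p i = of_rat q" using spec[OF p(1), of i] by (rule Rats_cases) blast
  qed
  then obtain q where "\<forall>i. coeff p i = of_rat (q i)" by (rule choice[THEN exE])
  then have q: "coeff p i = of_rat (q i)" for i by (rule spec)
  define n where "n = degree p"
  have qn: "of_rat (q n) \<noteq> (0 :: real)" using p(2) by (simp add: n_def flip: q)
  have "0 = (\<Sum>i\<le>n. of_rat (q i) * a ^ i)" using p(3) by (simp add: poly_altdef n_def q)
  also have "\<dots> = (\<Sum>i<n. of_rat (q i) * a ^ i) + of_rat (q n) * a ^ n"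
    by (simp add: lessThan_Suc_atMost[symmetric])
  finally have "a ^ n = - (\<Sum>i<n. of_rat (q i) * a ^ i) / of_rat (q n)"
    using qn by (simp add: field_simps)
  also have "\<dots> = (\<Sum>i<n. of_rat (- q i / q n) * a ^ i)"
    by (simp add: of_rat_divide of_rat_minus sum_divide_distrib sum_negf)
  finally show ?thesis by (rule that)
qed

text \<open>If \<open>a\<close> satisfies an equation of degree \<open>n\<close>, the products \<open>b * a ^ i\<close> with \<open>i < n\<close> span all \<open>b * a ^ k\<close>,
  since higher powers reduce to lower ones.\<close>
lemma spans_algebra_adjoin:
  fixes B :: "('x \<Rightarrow> real) set"
  assumes B: "spans_algebra B" and a: "algebraic a"
  shows "\<exists>B'. spans_algebra B' \<and> B \<subseteq> rat_fun.span B' \<and> (\<lambda>_. a) \<in> rat_fun.span B'"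
proof -
  obtain n and r :: "nat \<Rightarrow> rat" where rel: "a ^ n = (\<Sum>i<n. of_rat (r i) * a ^ i)"
    using algebraic_power_rewrite[OF a] by blast
  define pw :: "nat \<Rightarrow> 'x \<Rightarrow> real" where "pw k = (\<lambda>_. a ^ k)" for k
  define B' where "B' = (\<lambda>(b, i). b * pw i) ` (B \<times> {..<n})"
  have gen: "b * pw k \<in> rat_fun.span B'" if "b \<in> B" for b k
  proof (induction k rule: less_induct)
    case (less k)
    show ?case
    proof (cases "k < n")
      case True
      have "(\<lambda>(b, i). b * pw i) (b, k) \<in> B'"
        unfolding B'_def using that True by (intro imageI) simp
      then show ?thesis by (intro rat_fun.span_base) (simp only: prod.case)
    next
      case False
      have "a ^ k = a ^ (k - n) * a ^ n" using False by (simp flip: power_add)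
      also have "\<dots> = (\<Sum>i<n. of_rat (r i) * a ^ (k - n + i))"
        unfolding rel power_add sum_distrib_left by (simp only: mult_ac)
      finally have "a ^ k = (\<Sum>i<n. of_rat (r i) * a ^ (k - n + i))" .
      then have "b x * a ^ k = (\<Sum>i<n. of_rat (r i) * (b x * a ^ (k - n + i)))" for x
        by (simp add: sum_distrib_left mult_ac)
      moreover have "(\<Sum>i<m. rat_scale (r i) (b * pw (k - n + i))) x =
          (\<Sum>i<m. of_rat (r i) * (b x * a ^ (k - n + i)))" for x m
        by (induction m) (simp_all add: rat_scale_def pw_def)
      ultimately have "b * pw k = (\<Sum>i<n. rat_scale (r i) (b * pw (k - n + i)))"
        by (simp add: fun_eq_iff pw_def)
      also have "\<dots> \<in> rat_fun.span B'"
        using False by (intro rat_fun.span_sum rat_fun.span_scale less) auto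
      finally show ?thesis .
    qed
  qed
  have gen': "b * pw k \<in> rat_fun.span B'" if "b \<in> rat_fun.span B" for b k
    by (rule span_mult[OF that rat_fun.span_base[of "pw k" "{pw k}"]]) (auto intro: gen)
  have one: "1 \<in> rat_fun.span B" using B by (simp add: spans_algebra_def)
  have "spans_algebra B'"
    unfolding spans_algebra_def
  proof (intro conjI ballI)
    show "finite B'" using B by (simp add: B'_def spans_algebra_def)
    show "1 \<in> rat_fun.span B'"
      using gen'[OF one, of 0] by (simp add: pw_def flip: one_fun_def)
    fix b c assume "b \<in> B'" "c \<in> B'"
    then obtain b0 i c0 j where bc: "b = b0 * pw i" "c = c0 * pw j" "b0 \<in> B" "c0 \<in> B"
      by (auto simp: B'_def)
    have "b * c = (b0 * c0) * pw (i + j)"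
      by (simp add: bc fun_eq_iff pw_def power_add mult_ac)
    also have "\<dots> \<in> rat_fun.span B'"
      using B bc(3,4) by (intro gen') (auto simp: spans_algebra_def)
    finally show "b * c \<in> rat_fun.span B'" .
  qed
  moreover have "B \<subseteq> rat_fun.span B'"
  proof
    fix b assume "b \<in> B"
    moreover have "b * pw 0 = b" by (simp add: fun_eq_iff pw_def)
    ultimately show "b \<in> rat_fun.span B'" using gen[of b 0] by simp
  qed
  moreover have "(\<lambda>_. a) \<in> rat_fun.span B'"
  proof -
    have "1 * pw 1 = (\<lambda>_. a)" by (simp add: fun_eq_iff pw_def)
    then show ?thesis using gen'[OF one, of 1] by simp
  qed
  ultimately show ?thesis by blast
qed

lemma ex_spans_algebra:
  assumes "finite A" "\<And>a. a \<in> A \<Longrightarrow> algebraic (a :: real)"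
  shows "\<exists>B :: ('x \<Rightarrow> real) set. spans_algebra B \<and> (\<forall>a\<in>A. (\<lambda>_. a) \<in> rat_fun.span B)"
  using assms
proof (induction A rule: finite_induct)
  case empty
  have "spans_algebra {1 :: 'x \<Rightarrow> real}"
    by (auto simp: spans_algebra_def intro: rat_fun.span_base)
  then show ?case by blast
next
  case (insert a A)
  then obtain B :: "('x \<Rightarrow> real) set" where B: "spans_algebra B" "\<forall>a\<in>A. (\<lambda>_. a) \<in> rat_fun.span B"
    by auto
  obtain B' where B': "spans_algebra B'" "B \<subseteq> rat_fun.span B'" "(\<lambda>_. a) \<in> rat_fun.span B'"
    using spans_algebra_adjoin[OF B(1), of a] insert.prems by auto
  have "rat_fun.span B \<subseteq> rat_fun.span B'"
    using rat_fun.span_mono[OF B'(2)] by (simp add: rat_fun.span_span)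
  with B(2) B'(1,3) show ?case by (intro exI[of _ B']) auto
qed

section \<open>Polynomial functions and their algebraic dependence\<close>

definition monomial :: "('v::finite \<Rightarrow> nat) \<Rightarrow> ('v \<Rightarrow> real) \<Rightarrow> real" where
  "monomial \<alpha> x = (\<Prod>v\<in>UNIV. x v ^ \<alpha> v)"

text \<open>The degree bound is on each variable separately, not on the total degree.\<close>
definition polys_deg ::
  "(('v::finite \<Rightarrow> real) \<Rightarrow> real) set \<Rightarrow> nat \<Rightarrow> (('v \<Rightarrow> real) \<Rightarrow> real) set" where
  "polys_deg B k = rat_fun.span ((\<lambda>(b, \<alpha>). b * monomial \<alpha>) ` (B \<times> {\<alpha>. \<forall>v. \<alpha> v \<le> k}))"

definition polys :: "(('v::finite \<Rightarrow> real) \<Rightarrow> real) set \<Rightarrow> (('v \<Rightarrow> real) \<Rightarrow> real) set" where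
  "polys B = (\<Union>k. polys_deg B k)"

lemma bounded_exponents_eq: "{\<alpha> :: 'v \<Rightarrow> nat. \<forall>v. \<alpha> v \<le> k} = UNIV \<rightarrow>\<^sub>E {..k}"
  by (auto simp: PiE_def)

lemma finite_bounded_exponents: "finite {\<alpha> :: 'v::finite \<Rightarrow> nat. \<forall>v. \<alpha> v \<le> k}"
  unfolding bounded_exponents_eq by (intro finite_PiE) auto

lemma card_bounded_exponents: "card {\<alpha> :: 'v::finite \<Rightarrow> nat. \<forall>v. \<alpha> v \<le> k} = (k + 1) ^ CARD('v)"
  unfolding bounded_exponents_eq by (simp add: card_PiE)

lemma polys_deg_mono: "k \<le> l \<Longrightarrow> polys_deg B k \<subseteq> polys_deg B l"
  unfolding polys_deg_def
  by (intro rat_fun.span_mono image_mono Sigma_mono) (auto intro: order_trans)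

lemma span_mult_monomial:
  assumes "b \<in> rat_fun.span B" "\<And>v. \<alpha> v \<le> k"
  shows "b * monomial \<alpha> \<in> polys_deg B k"
  unfolding polys_deg_def
  by (rule span_mult[OF assms(1) rat_fun.span_base[of "monomial \<alpha>" "{monomial \<alpha>}"]])
    (use assms(2) in \<open>auto intro!: rat_fun.span_base\<close>)

definition exponents :: "'k set \<Rightarrow> nat \<Rightarrow> ('k \<Rightarrow> nat) set" where
  "exponents J d = {\<gamma>. (\<forall>j. \<gamma> j \<le> d) \<and> (\<forall>j\<in>J. \<gamma> j = 0)}"

definition rat_poly :: "'k set \<Rightarrow> nat \<Rightarrow> (('k::finite \<Rightarrow> nat) \<Rightarrow> rat) \<Rightarrow> ('k \<Rightarrow> real) \<Rightarrow> real" where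
  "rat_poly J d c y = (\<Sum>\<gamma>\<in>exponents J d. of_rat (c \<gamma>) * monomial \<gamma> y)"

lemma finite_exponents: "finite (exponents J d :: ('k::finite \<Rightarrow> nat) set)"
  by (rule finite_subset[OF _ finite_bounded_exponents[of d]]) (auto simp: exponents_def)

context
  fixes B :: "(('v::finite \<Rightarrow> real) \<Rightarrow> real) set"
  assumes B: "spans_algebra B"
begin

lemma polys_deg_mult:
  assumes "f \<in> polys_deg B k" "g \<in> polys_deg B l"
  shows "f * g \<in> polys_deg B (k + l)"
  using assms unfolding polys_deg_def[of B k] polys_deg_def[of B l] polys_deg_def[of B "k + l"]
proof (rule span_mult)
  fix s t assume "s \<in> (\<lambda>(b, \<alpha>). b * monomial \<alpha>) ` (B \<times> {\<alpha>. \<forall>v. \<alpha> v \<le> k})"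
    "t \<in> (\<lambda>(b, \<alpha>). b * monomial \<alpha>) ` (B \<times> {\<alpha>. \<forall>v. \<alpha> v \<le> l})"
  then obtain b \<alpha> c \<gamma> where st: "s = b * monomial \<alpha>" "t = c * monomial \<gamma>" "b \<in> B" "c \<in> B"
      "\<forall>v. \<alpha> v \<le> k" "\<forall>v. \<gamma> v \<le> l" by auto
  have "s * t = (b * c) * monomial (\<lambda>v. \<alpha> v + \<gamma> v)"
    by (simp add: st fun_eq_iff monomial_def power_add prod.distrib mult_ac)
  also have "\<dots> \<in> polys_deg B (k + l)"
    using B st by (intro span_mult_monomial) (auto simp: spans_algebra_def intro: add_mono)
  finally show "s * t \<in> rat_fun.span ((\<lambda>(b, \<alpha>). b * monomial \<alpha>) ` (B \<times> {\<alpha>. \<forall>v. \<alpha> v \<le> k + l}))"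
    by (simp add: polys_deg_def)
qed

lemma constant_polys_deg: "b \<in> rat_fun.span B \<Longrightarrow> b \<in> polys_deg B k"
  using span_mult_monomial[of b B "\<lambda>_. 0" k] by (simp add: monomial_def[abs_def] flip: one_fun_def)

lemma one_polys_deg: "1 \<in> polys_deg B k"
  using B by (intro constant_polys_deg) (simp add: spans_algebra_def)

lemma polys_deg_power: "f \<in> polys_deg B k \<Longrightarrow> f ^ n \<in> polys_deg B (n * k)"
proof (induction n)
  case 0
  show ?case unfolding power_0 by (rule one_polys_deg)
next
  case (Suc n)
  then show ?case
    unfolding power_Suc mult_Suc by (intro polys_deg_mult)
qed

lemma polys_deg_prod:
  "(\<And>j. j \<in> J \<Longrightarrow> f j \<in> polys_deg B k) \<Longrightarrow> (\<Prod>j\<in>J. f j) \<in> polys_deg B (card J * k)"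
proof (induction J rule: infinite_finite_induct)
  case (insert j J)
  have "f j * prod f J \<in> polys_deg B (k + card J * k)"
    using insert by (intro polys_deg_mult) auto
  then show ?case
    unfolding prod.insert[OF insert(1,2)] card_insert_disjoint[OF insert(1,2)] mult_Suc .
next
  case empty
  show ?case unfolding prod.empty by (rule one_polys_deg)
next
  case (infinite J)
  then show ?case unfolding prod.infinite[OF infinite(1)] by (intro one_polys_deg)
qed

lemma coordinate_in_polys: "(\<lambda>x. x v) \<in> polys B"
proof -
  have "1 * monomial (\<lambda>w. if w = v then 1 else 0) = (\<lambda>x :: 'v \<Rightarrow> real. x v)"
    by (simp add: fun_eq_iff monomial_def if_distrib[of "power _"] prod.delta cong: if_cong)
  moreover have "1 * monomial (\<lambda>w. if w = v then 1 else 0) \<in> polys_deg B 1"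
    using B by (intro span_mult_monomial) (auto simp: spans_algebra_def)
  ultimately show ?thesis unfolding polys_def by auto
qed

lemma constant_in_polys: "b \<in> rat_fun.span B \<Longrightarrow> b \<in> polys B"
  using constant_polys_deg unfolding polys_def by blast

lemma function_ring_polys: "function_ring (polys B)"
proof
  show "(\<lambda>_. 1) \<in> polys B"
    using one_polys_deg unfolding polys_def by (auto simp: one_fun_def)
  fix f g assume "f \<in> polys B" "g \<in> polys B"
  then obtain k l where kl: "f \<in> polys_deg B k" "g \<in> polys_deg B l" by (auto simp: polys_def)
  have "f * g \<in> polys B" using polys_deg_mult[OF kl] by (auto simp: polys_def)
  then show "(\<lambda>x. f x * g x) \<in> polys B" by (simp add: times_fun_def)
  have "f \<in> polys_deg B (max k l)" "g \<in> polys_deg B (max k l)"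
    using kl polys_deg_mono[of k "max k l" B] polys_deg_mono[of l "max k l" B] by auto
  then have "f - g \<in> polys_deg B (max k l)"
    unfolding polys_deg_def by (rule rat_fun.span_diff)
  then show "(\<lambda>x. f x - g x) \<in> polys B" by (auto simp: polys_def fun_diff_def)
qed

text \<open>More rational functions \<open>n j / D j\<close> than variables are algebraically dependent over the rationals.
  Multiplied by the common denominator \<open>\<Prod>j. D j ^ d\<close>, the monomials in them with exponents at most \<open>d\<close> become
  polynomial functions of degree at most \<open>d * E\<close> in each variable. Their number, a power of \<open>d + 1\<close> with exponent
  at least \<open>CARD('v) + 1\<close>, exceeds the dimension \<open>card B * (d * E + 1) ^ CARD('v)\<close> at our disposal once \<open>d\<close> is
  large. The number \<open>d\<close> depends on the fractions only through the degree bound \<open>C\<close>; the weights of the later substitution can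
  therefore be fixed before the fractions are.\<close>
lemma algebraic_dependence:
  assumes card: "CARD('v) < CARD('k::finite)"
  shows "\<exists>d. \<forall>n D :: 'k \<Rightarrow> ('v \<Rightarrow> real) \<Rightarrow> real.
    (\<forall>j. n j \<in> polys_deg B C \<and> D j \<in> polys_deg B C) \<longrightarrow>
    (\<exists>c. (\<exists>\<gamma>\<in>exponents {} d. c \<gamma> \<noteq> 0) \<and>
      (\<forall>x y. (\<forall>j. D j x \<noteq> 0 \<and> D j x * y j = n j x) \<longrightarrow> rat_poly {} d c y = 0))"
proof -
  define E where "E = CARD('k) * C"
  define d where "d = card B * (E + 1) ^ CARD('v)"
  define T where "T = (\<lambda>(b, \<alpha> :: 'v \<Rightarrow> nat). b * monomial \<alpha>) ` (B \<times> {\<alpha>. \<forall>v. \<alpha> v \<le> d * E})"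
  define \<Gamma> where "\<Gamma> = (exponents {} d :: ('k \<Rightarrow> nat) set)"
  have \<Gamma>: "\<Gamma> = {\<gamma>. \<forall>j. \<gamma> j \<le> d}" by (simp add: \<Gamma>_def exponents_def)
  have finB: "finite B" using B by (simp add: spans_algebra_def)
  have fin: "finite (B \<times> {\<alpha> :: 'v \<Rightarrow> nat. \<forall>v. \<alpha> v \<le> d * E})"
    by (intro finite_cartesian_product finB finite_bounded_exponents)
  have finT: "finite T" unfolding T_def by (rule finite_imageI[OF fin])
  have "card T \<le> card B * (d * E + 1) ^ CARD('v)"
    using card_image_le[OF fin]
    unfolding T_def card_cartesian_product card_bounded_exponents .
  also have "\<dots> \<le> card B * ((E + 1) * (d + 1)) ^ CARD('v)"
    by (intro mult_left_mono power_mono) (auto simp: algebra_simps)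
  also have "\<dots> = d * (d + 1) ^ CARD('v)" by (simp only: d_def power_mult_distrib mult.assoc)
  also have "\<dots> < (d + 1) ^ Suc (CARD('v))" by simp
  also have "\<dots> \<le> (d + 1) ^ CARD('k)" using card by (intro power_increasing) auto
  finally have lt: "card T < card \<Gamma>" by (simp add: \<Gamma> card_bounded_exponents)
  show ?thesis
  proof (intro exI[of _ d] allI impI)
    fix n D :: "'k \<Rightarrow> ('v \<Rightarrow> real) \<Rightarrow> real"
    assume nD: "\<forall>j. n j \<in> polys_deg B C \<and> D j \<in> polys_deg B C"
    define f where "f \<gamma> = (\<Prod>j\<in>UNIV. D j ^ (d - \<gamma> j) * n j ^ \<gamma> j)" for \<gamma> :: "'k \<Rightarrow> nat"
    have "f \<gamma> \<in> polys_deg B (d * E)" if "\<gamma> \<in> \<Gamma>" for \<gamma>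
    proof -
      have "D j ^ (d - \<gamma> j) * n j ^ \<gamma> j \<in> polys_deg B (d * C)" for j
      proof -
        have "(d - \<gamma> j) * C + \<gamma> j * C = d * C" using that by (simp add: \<Gamma> flip: add_mult_distrib)
        then show ?thesis
          using polys_deg_mult[OF polys_deg_power polys_deg_power, of "D j" C "n j" C "d - \<gamma> j" "\<gamma> j"] nD
          by simp
      qed
      then have "f \<gamma> \<in> polys_deg B (CARD('k) * (d * C))"
        unfolding f_def by (intro polys_deg_prod)
      then show ?thesis by (simp add: E_def mult_ac)
    qed
    then have sub: "f ` \<Gamma> \<subseteq> rat_fun.span T" by (auto simp: T_def polys_deg_def)
    have "finite \<Gamma>" unfolding \<Gamma>_def by (rule finite_exponents)
    from ex_rational_relation[OF finT this sub lt] obtain c where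
      c: "\<exists>\<gamma>\<in>\<Gamma>. c \<gamma> \<noteq> 0" "\<forall>x. (\<Sum>\<gamma>\<in>\<Gamma>. of_rat (c \<gamma>) * f \<gamma> x) = 0"
      by (elim exE conjE) (rule that)
    have "(\<Sum>\<gamma>\<in>\<Gamma>. of_rat (c \<gamma>) * monomial \<gamma> y) = 0"
      if y: "\<forall>j. D j x \<noteq> 0 \<and> D j x * y j = n j x" for x y
    proof -
      have prod_apply: "(\<Prod>j\<in>A. g j) x = (\<Prod>j\<in>A. g j x)" for A and g :: "'k \<Rightarrow> ('v \<Rightarrow> real) \<Rightarrow> real"
        by (induction A rule: infinite_finite_induct) auto
      have power_apply: "(g ^ m) x = g x ^ m" for g :: "('v \<Rightarrow> real) \<Rightarrow> real" and m
        by (induction m) auto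
      define \<Delta> where "\<Delta> = (\<Prod>j\<in>UNIV. D j x ^ d)"
      have "f \<gamma> x = \<Delta> * monomial \<gamma> y" if "\<gamma> \<in> \<Gamma>" for \<gamma>
      proof -
        have "D j x ^ (d - \<gamma> j) * n j x ^ \<gamma> j = D j x ^ d * y j ^ \<gamma> j" for j
        proof -
          have "n j x ^ \<gamma> j = D j x ^ \<gamma> j * y j ^ \<gamma> j" using y by (metis power_mult_distrib)
          moreover have "D j x ^ (d - \<gamma> j) * D j x ^ \<gamma> j = D j x ^ d"
            using that by (simp add: \<Gamma> flip: power_add)
          ultimately show ?thesis by (simp flip: mult.assoc)
        qed
        then show ?thesis
          by (simp add: f_def prod_apply power_apply \<Delta>_def monomial_def flip: prod.distrib)
      qed
      then have "\<Delta> * (\<Sum>\<gamma>\<in>\<Gamma>. of_rat (c \<gamma>) * monomial \<gamma> y) = (\<Sum>\<gamma>\<in>\<Gamma>. of_rat (c \<gamma>) * f \<gamma> x)"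
        by (simp add: sum_distrib_left mult_ac cong: sum.cong)
      also have "\<dots> = 0" using c(2) by blast
      finally show ?thesis using y by (simp add: \<Delta>_def)
    qed
    with c(1) show "\<exists>c. (\<exists>\<gamma>\<in>exponents {} d. c \<gamma> \<noteq> 0) \<and>
      (\<forall>x y. (\<forall>j. D j x \<noteq> 0 \<and> D j x * y j = n j x) \<longrightarrow> rat_poly {} d c y = 0)"
      unfolding rat_poly_def \<Gamma>_def[symmetric] by (intro exI[of _ c]) simp
  qed
qed

end

section \<open>Eliminating infinitesimal variables\<close>

text \<open>Under the substitution \<open>y j = \<epsilon> ^ \<omega> j\<close> for \<open>j \<in> J\<close>, distinct monomials of bounded degree in these variables become
  distinct powers of \<open>\<epsilon>\<close>.\<close>
definition separating :: "'k set \<Rightarrow> nat \<Rightarrow> ('k \<Rightarrow> nat) \<Rightarrow> bool" where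
  "separating J d \<omega> \<longleftrightarrow> (\<forall>\<gamma> \<gamma>'. (\<forall>j\<in>J. \<gamma> j \<le> d \<and> \<gamma>' j \<le> d) \<longrightarrow>
     (\<Sum>j\<in>J. \<omega> j * \<gamma> j) = (\<Sum>j\<in>J. \<omega> j * \<gamma>' j) \<longrightarrow> (\<forall>j\<in>J. \<gamma> j = \<gamma>' j))"

text \<open>Kronecker substitution: with powers of \<open>d + 1\<close> as weights, the exponents are the digits of the
  weighted sum in base \<open>d + 1\<close>.\<close>
lemma ex_separating_weights:
  assumes "finite J"
  shows "\<exists>\<omega>. (\<forall>j. 1 \<le> \<omega> j) \<and> separating J d \<omega>"
  using assms
proof (induction J rule: finite_induct)
  case empty
  show ?case by (intro exI[of _ "\<lambda>_. 1"]) (simp add: separating_def)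
next
  case (insert a J)
  then obtain \<omega> where \<omega>: "\<forall>j. 1 \<le> \<omega> j" "separating J d \<omega>" by blast
  define \<omega>' where "\<omega>' j = (if j = a then 1 else (d + 1) * \<omega> j)" for j
  have sum: "(\<Sum>j\<in>insert a J. \<omega>' j * \<gamma> j) = \<gamma> a + (d + 1) * (\<Sum>j\<in>J. \<omega> j * \<gamma> j)" for \<gamma>
  proof -
    have "(\<Sum>j\<in>J. \<omega>' j * \<gamma> j) = (\<Sum>j\<in>J. (d + 1) * (\<omega> j * \<gamma> j))"
      using insert.hyps(2) by (intro sum.cong) (auto simp: \<omega>'_def mult.assoc simp del: mult_Suc)
    then show ?thesis using insert.hyps by (simp add: \<omega>'_def sum_distrib_left)
  qed
  have "separating (insert a J) d \<omega>'"
    unfolding separating_def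
  proof (intro allI impI)
    fix \<gamma> \<gamma>' assume le: "\<forall>j\<in>insert a J. \<gamma> j \<le> d \<and> \<gamma>' j \<le> d"
      and eq: "(\<Sum>j\<in>insert a J. \<omega>' j * \<gamma> j) = (\<Sum>j\<in>insert a J. \<omega>' j * \<gamma>' j)"
    have digit: "(t + (d + 1) * q) mod (d + 1) = t" "(t + (d + 1) * q) div (d + 1) = q"
      if "t \<le> d" for t q :: nat
      using that by (simp_all only: mod_mult_self2 div_mult_self2) simp_all
    have "\<gamma> a = \<gamma>' a" "(\<Sum>j\<in>J. \<omega> j * \<gamma> j) = (\<Sum>j\<in>J. \<omega> j * \<gamma>' j)"
      using digit[of "\<gamma> a"] digit[of "\<gamma>' a"] le eq unfolding sum by (metis insertI1)+
    moreover have "\<forall>j\<in>J. \<gamma> j = \<gamma>' j"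
      using \<omega>(2) le calculation(2) unfolding separating_def by blast
    ultimately show "\<forall>j\<in>insert a J. \<gamma> j = \<gamma>' j" by simp
  qed
  moreover have "\<forall>j. 1 \<le> \<omega>' j"
  proof
    fix j
    have "1 * 1 \<le> (d + 1) * \<omega> j" using \<omega>(1) by (intro mult_le_mono) auto
    then show "1 \<le> \<omega>' j" by (simp add: \<omega>'_def)
  qed
  ultimately show ?case by blast
qed

lemma frequently_zero_limit:
  fixes F :: "nat \<Rightarrow> real"
  assumes "F \<longlonglongrightarrow> L" "\<exists>\<^sub>F n in sequentially. F n = 0"
  shows "L = 0"
proof (rule ccontr)
  assume "L \<noteq> 0"
  then have "\<forall>\<^sub>F n in sequentially. F n \<noteq> 0" by (rule tendsto_imp_eventually_ne[OF assms(1)])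
  with assms(2) show False by (simp add: frequently_def)
qed

text \<open>Order the relation \<open>rat_poly {} d c (Y n) = 0\<close> by powers of \<open>\<epsilon> n\<close>. The separating weights ensure that one single
  monomial \<open>\<gamma>0\<close> in the variables of \<open>J\<close> contributes to the lowest occurring power \<open>m\<close>, hence no cancellation
  takes place and its coefficient, a polynomial in the other variables, is not zero. After division by
  \<open>\<epsilon> n ^ m\<close> only this coefficient survives in the limit.\<close>
lemma lowest_order_coefficient:
  fixes c :: "('k::finite \<Rightarrow> nat) \<Rightarrow> rat"
  assumes sep: "separating J d \<omega>" and c: "\<exists>\<gamma>\<in>exponents {} d. c \<gamma> \<noteq> 0"
  shows "\<exists>c'. (\<exists>\<gamma>\<in>exponents J d. c' \<gamma> \<noteq> 0) \<and>
    (\<forall>Y \<epsilon> y. \<epsilon> \<longlonglongrightarrow> 0 \<longrightarrow> (\<forall>n. 0 < \<epsilon> n) \<longrightarrow> (\<forall>n. \<forall>j\<in>J. Y n j = \<epsilon> n ^ \<omega> j) \<longrightarrow>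
       (\<forall>j\<in>- J. (\<lambda>n. Y n j) \<longlonglongrightarrow> y j) \<longrightarrow> (\<exists>\<^sub>F n in sequentially. rat_poly {} d c (Y n) = 0) \<longrightarrow>
       rat_poly J d c' y = 0)"
proof -
  define wt where "wt \<gamma> = (\<Sum>j\<in>J. \<omega> j * \<gamma> j)" for \<gamma> :: "'k \<Rightarrow> nat"
  define S where "S = {\<gamma> \<in> exponents {} d. c \<gamma> \<noteq> 0}"
  have finS: "finite S" unfolding S_def by (rule finite_subset[OF _ finite_exponents[of "{}" d]]) auto
  have "S \<noteq> {}" using c by (auto simp: S_def)
  define m where "m = Min (wt ` S)"
  have "m \<in> wt ` S" unfolding m_def using finS \<open>S \<noteq> {}\<close> by (intro Min_in) auto
  then obtain \<gamma>0 where \<gamma>0: "\<gamma>0 \<in> S" "wt \<gamma>0 = m" by blast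
  have m_le: "m \<le> wt \<gamma>" if "\<gamma> \<in> S" for \<gamma> unfolding m_def using finS that by (intro Min_le) auto
  define up where "up \<gamma> = (\<lambda>j. if j \<in> J then \<gamma>0 j else \<gamma> j)" for \<gamma> :: "'k \<Rightarrow> nat"
  define down where "down \<gamma> = (\<lambda>j. if j \<in> J then 0 else \<gamma> j)" for \<gamma> :: "'k \<Rightarrow> nat"
  have \<gamma>0_le: "\<gamma>0 j \<le> d" for j using \<gamma>0(1) by (auto simp: S_def exponents_def)
  have wt_iff: "wt \<gamma> = m \<longleftrightarrow> (\<forall>j\<in>J. \<gamma> j = \<gamma>0 j)" if "\<gamma> \<in> exponents {} d" for \<gamma>
  proof
    assume "wt \<gamma> = m"
    then have eq: "(\<Sum>j\<in>J. \<omega> j * \<gamma> j) = (\<Sum>j\<in>J. \<omega> j * \<gamma>0 j)" using \<gamma>0(2) by (simp add: wt_def)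
    have "\<forall>j\<in>J. \<gamma> j \<le> d \<and> \<gamma>0 j \<le> d" using that \<gamma>0_le by (auto simp: exponents_def)
    with sep eq show "\<forall>j\<in>J. \<gamma> j = \<gamma>0 j" unfolding separating_def by blast
  next
    assume "\<forall>j\<in>J. \<gamma> j = \<gamma>0 j"
    then have "wt \<gamma> = wt \<gamma>0" unfolding wt_def by (intro sum.cong) auto
    then show "wt \<gamma> = m" using \<gamma>0(2) by simp
  qed
  have up_down: "up (down \<gamma>0) = \<gamma>0" by (auto simp: up_def down_def)
  have "\<exists>\<gamma>\<in>exponents J d. c (up \<gamma>) \<noteq> 0"
  proof (rule bexI[of _ "down \<gamma>0"])
    show "down \<gamma>0 \<in> exponents J d" using \<gamma>0_le by (auto simp: down_def exponents_def)
    show "c (up (down \<gamma>0)) \<noteq> 0" unfolding up_down using \<gamma>0(1) by (simp add: S_def)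
  qed
  moreover have "rat_poly J d (\<lambda>\<gamma>. c (up \<gamma>)) y = 0"
    if \<epsilon>: "\<epsilon> \<longlonglongrightarrow> 0" "\<forall>n. 0 < \<epsilon> n" and YJ: "\<forall>n. \<forall>j\<in>J. Y n j = \<epsilon> n ^ \<omega> j"
      and Yy: "\<forall>j\<in>- J. (\<lambda>n. Y n j) \<longlonglongrightarrow> y j"
      and fr: "\<exists>\<^sub>F n in sequentially. rat_poly {} d c (Y n) = 0" for Y \<epsilon> y
  proof -
    define rest where "rest \<gamma> x = (\<Prod>j\<in>- J. x j ^ \<gamma> j)" for \<gamma> :: "'k \<Rightarrow> nat" and x :: "'k \<Rightarrow> real"
    have split: "monomial \<gamma> x = (\<Prod>j\<in>J. x j ^ \<gamma> j) * rest \<gamma> x" for \<gamma> x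
      unfolding monomial_def rest_def
      by (subst prod.union_disjoint[symmetric]) (auto simp: Compl_partition)
    have mono: "monomial \<gamma> (Y n) = \<epsilon> n ^ wt \<gamma> * rest \<gamma> (Y n)" for \<gamma> n
    proof -
      have "(\<Prod>j\<in>J. Y n j ^ \<gamma> j) = (\<Prod>j\<in>J. \<epsilon> n ^ (\<omega> j * \<gamma> j))"
        using YJ by (intro prod.cong) (auto simp: power_mult)
      then show ?thesis by (simp add: split wt_def power_sum)
    qed
    define F where "F n = (\<Sum>\<gamma>\<in>S. of_rat (c \<gamma>) * (\<epsilon> n ^ (wt \<gamma> - m) * rest \<gamma> (Y n)))" for n
    define L where "L = (\<Sum>\<gamma>\<in>S. of_rat (c \<gamma>) * ((if wt \<gamma> = m then 1 else 0) * rest \<gamma> y))"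
    have factor: "rat_poly {} d c (Y n) = \<epsilon> n ^ m * F n" for n
    proof -
      have "rat_poly {} d c (Y n) = (\<Sum>\<gamma>\<in>S. of_rat (c \<gamma>) * monomial \<gamma> (Y n))"
        unfolding rat_poly_def S_def
        by (rule sum.mono_neutral_right) (auto simp: finite_exponents)
      also have "\<dots> = (\<Sum>\<gamma>\<in>S. \<epsilon> n ^ m * (of_rat (c \<gamma>) * (\<epsilon> n ^ (wt \<gamma> - m) * rest \<gamma> (Y n))))"
      proof (rule sum.cong[OF refl])
        fix \<gamma> assume "\<gamma> \<in> S"
        then have "\<epsilon> n ^ wt \<gamma> = \<epsilon> n ^ m * \<epsilon> n ^ (wt \<gamma> - m)" using m_le by (simp flip: power_add)
        then show "of_rat (c \<gamma>) * monomial \<gamma> (Y n) =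
            \<epsilon> n ^ m * (of_rat (c \<gamma>) * (\<epsilon> n ^ (wt \<gamma> - m) * rest \<gamma> (Y n)))"
          by (simp add: mono mult_ac)
      qed
      finally show ?thesis by (simp add: F_def sum_distrib_left)
    qed
    have "F \<longlonglongrightarrow> L"
      unfolding F_def L_def
    proof (intro tendsto_sum tendsto_mult tendsto_const)
      fix \<gamma> assume "\<gamma> \<in> S"
      show "(\<lambda>n. rest \<gamma> (Y n)) \<longlonglongrightarrow> rest \<gamma> y"
        unfolding rest_def using Yy by (intro tendsto_prod tendsto_power) auto
      show "(\<lambda>n. \<epsilon> n ^ (wt \<gamma> - m)) \<longlonglongrightarrow> (if wt \<gamma> = m then 1 else 0)"
      proof (cases "wt \<gamma> = m")
        case False
        then have "wt \<gamma> - m > 0" using m_le[OF \<open>\<gamma> \<in> S\<close>] by simp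
        then show ?thesis using tendsto_power[OF \<epsilon>(1), of "wt \<gamma> - m"] False by (simp add: power_0_left)
      qed simp
    qed
    moreover have "\<exists>\<^sub>F n in sequentially. F n = 0"
      using fr by (rule frequently_elim1) (use \<epsilon>(2) in \<open>simp add: factor less_imp_neq[symmetric]\<close>)
    ultimately have "L = 0" by (rule frequently_zero_limit)
    have "L = (\<Sum>\<gamma>\<in>{\<gamma> \<in> exponents {} d. \<forall>j\<in>J. \<gamma> j = \<gamma>0 j}. of_rat (c \<gamma>) * rest \<gamma> y)"
    proof -
      have "L = (\<Sum>\<gamma>\<in>exponents {} d. of_rat (c \<gamma>) * ((if wt \<gamma> = m then 1 else 0) * rest \<gamma> y))"
        unfolding L_def S_def by (rule sum.mono_neutral_left) (auto simp: finite_exponents)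
      also have "\<dots> = (\<Sum>\<gamma>\<in>exponents {} d. if \<forall>j\<in>J. \<gamma> j = \<gamma>0 j then of_rat (c \<gamma>) * rest \<gamma> y else 0)"
        by (intro sum.cong refl) (simp add: wt_iff)
      also have "\<dots> = (\<Sum>\<gamma>\<in>{\<gamma> \<in> exponents {} d. \<forall>j\<in>J. \<gamma> j = \<gamma>0 j}. of_rat (c \<gamma>) * rest \<gamma> y)"
        by (rule sum.inter_filter[symmetric, OF finite_exponents])
      finally show ?thesis .
    qed
    also have "\<dots> = rat_poly J d (\<lambda>\<gamma>. c (up \<gamma>)) y"
      unfolding rat_poly_def
    proof (rule sum.reindex_bij_witness[of _ up down])
      fix \<gamma> assume \<gamma>: "\<gamma> \<in> {\<gamma> \<in> exponents {} d. \<forall>j\<in>J. \<gamma> j = \<gamma>0 j}"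
      show "up (down \<gamma>) = \<gamma>" using \<gamma> by (auto simp: up_def down_def)
      show "down \<gamma> \<in> exponents J d" using \<gamma> by (auto simp: down_def exponents_def)
      have "monomial (down \<gamma>) y = rest \<gamma> y"
        by (simp add: split) (simp add: rest_def down_def)
      then show "of_rat (c (up (down \<gamma>))) * monomial (down \<gamma>) y = of_rat (c \<gamma>) * rest \<gamma> y"
        using \<open>up (down \<gamma>) = \<gamma>\<close> by simp
    next
      fix \<gamma> assume \<gamma>: "\<gamma> \<in> exponents J d"
      show "down (up \<gamma>) = \<gamma>" using \<gamma> by (auto simp: up_def down_def exponents_def)
      show "up \<gamma> \<in> {\<gamma> \<in> exponents {} d. \<forall>j\<in>J. \<gamma> j = \<gamma>0 j}"
        using \<gamma> \<gamma>0_le by (auto simp: up_def exponents_def)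
    qed
    finally show ?thesis using \<open>L = 0\<close> by simp
  qed
  ultimately show ?thesis by (intro exI[of _ "\<lambda>\<gamma>. c (up \<gamma>)"] conjI allI impI)
qed

lemma frequently_finite_choice:
  assumes "finite R" "\<And>n. \<exists>\<rho>\<in>R. Q \<rho> n"
  shows "\<exists>\<rho>\<in>R. \<exists>\<^sub>F n in sequentially. Q \<rho> n"
proof (rule ccontr)
  assume "\<not> ?thesis"
  then have "\<forall>\<rho>\<in>R. \<forall>\<^sub>F n in sequentially. \<not> Q \<rho> n" by (simp add: frequently_def)
  then have "\<forall>\<^sub>F n in sequentially. \<forall>\<rho>\<in>R. \<not> Q \<rho> n" by (intro eventually_ball_finite assms(1))
  then obtain n where "\<forall>\<rho>\<in>R. \<not> Q \<rho> n" by (auto simp: eventually_sequentially)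
  with assms(2)[of n] show False by blast
qed

lemma finite_subset_polys_degree:
  assumes "finite F" "F \<subseteq> polys B"
  shows "\<exists>C. F \<subseteq> polys_deg B C"
  using assms
proof (induction F rule: finite_induct)
  case (insert f F)
  then obtain C where C: "F \<subseteq> polys_deg B C" by auto
  obtain k where k: "f \<in> polys_deg B k" using insert.prems by (auto simp: polys_def)
  have "insert f F \<subseteq> polys_deg B (max C k)"
    using C k polys_deg_mono[of C "max C k" B] polys_deg_mono[of k "max C k" B] by auto
  then show ?case by blast
qed simp

text \<open>The variables \<open>x\<close> run along a sequence on which the functions \<open>h j\<close> with \<open>j \<in> J\<close> tend to \<open>0\<close> at prescribed
  rates and the others have limits \<open>y j\<close>; then these limits satisfy one of finitely many nontrivial polynomial
  equations. Along the sequence the fractions that represent the \<open>h j\<close> may change, but some choice of them recurs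
  infinitely often.\<close>
theorem elimination:
  fixes h :: "'k::finite \<Rightarrow> ('v::finite \<Rightarrow> real) \<Rightarrow> real"
  assumes B: "spans_algebra B" and card: "CARD('v) < CARD('k)"
    and h: "\<And>j. function_ring.piecewise_rational (polys B) UNIV (h j)"
  shows "\<exists>d \<omega> Q. finite Q \<and> (\<forall>c\<in>Q. \<exists>\<gamma>\<in>exponents J d. c \<gamma> \<noteq> 0) \<and> (\<forall>j. 1 \<le> \<omega> j) \<and>
    (\<forall>x \<epsilon> y. \<epsilon> \<longlonglongrightarrow> 0 \<longrightarrow> (\<forall>n. 0 < \<epsilon> n) \<longrightarrow> (\<forall>n. \<forall>j\<in>J. h j (x n) = \<epsilon> n ^ \<omega> j) \<longrightarrow>
       (\<forall>j\<in>- J. (\<lambda>n. h j (x n)) \<longlonglongrightarrow> y j) \<longrightarrow> (\<exists>c\<in>Q. rat_poly J d c y = 0))"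
proof -
  interpret function_ring "polys B" by (rule function_ring_polys[OF B])
  have "\<forall>j. \<exists>R. finite R \<and> R \<subseteq> polys B \<times> polys B \<and>
      (\<forall>x. \<exists>n D. (n, D) \<in> R \<and> D x \<noteq> 0 \<and> D x * h j x = n x)"
    using h by (simp add: piecewise_rational_def)
  then obtain R where "\<forall>j. finite (R j) \<and> R j \<subseteq> polys B \<times> polys B \<and>
      (\<forall>x. \<exists>n D. (n, D) \<in> R j \<and> D x \<noteq> 0 \<and> D x * h j x = n x)"
    by (rule choice[THEN exE])
  then have R: "finite (R j)" "R j \<subseteq> polys B \<times> polys B"
      "\<exists>n D. (n, D) \<in> R j \<and> D x \<noteq> 0 \<and> D x * h j x = n x" for j x
    by simp_all
  have "\<exists>C. (\<Union>j. fst ` R j \<union> snd ` R j) \<subseteq> polys_deg B C"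
  proof (rule finite_subset_polys_degree)
    show "finite (\<Union>j. fst ` R j \<union> snd ` R j)" using R(1) by simp
    have "fst r \<in> polys B" "snd r \<in> polys B" if "r \<in> R j" for r j
      using subsetD[OF R(2) that] by (simp_all add: mem_Times_iff)
    then show "(\<Union>j. fst ` R j \<union> snd ` R j) \<subseteq> polys B" by blast
  qed
  then obtain C where C: "(\<Union>j. fst ` R j \<union> snd ` R j) \<subseteq> polys_deg B C" ..
  obtain d where d: "\<forall>n D :: 'k \<Rightarrow> ('v \<Rightarrow> real) \<Rightarrow> real.
    (\<forall>j. n j \<in> polys_deg B C \<and> D j \<in> polys_deg B C) \<longrightarrow>
    (\<exists>c. (\<exists>\<gamma>\<in>exponents {} d. c \<gamma> \<noteq> 0) \<and>
      (\<forall>x y. (\<forall>j. D j x \<noteq> 0 \<and> D j x * y j = n j x) \<longrightarrow> rat_poly {} d c y = 0))"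
    using algebraic_dependence[OF B card, of C] ..
  obtain \<omega> where \<omega>: "\<forall>j. 1 \<le> \<omega> j" "separating J d \<omega>"
    using ex_separating_weights[of J d] by auto
  define valid where "valid \<rho> x \<longleftrightarrow> (\<forall>j. snd (\<rho> j) x \<noteq> 0 \<and> snd (\<rho> j) x * h j x = fst (\<rho> j) x)"
    for \<rho> :: "'k \<Rightarrow> (('v \<Rightarrow> real) \<Rightarrow> real) \<times> (('v \<Rightarrow> real) \<Rightarrow> real)" and x
  define \<R> where "\<R> = PiE UNIV R"
  have "finite \<R>" unfolding \<R>_def using R(1) by (intro finite_PiE) auto
  have ex_valid: "\<exists>\<rho>\<in>\<R>. valid \<rho> x" for x
  proof -
    have "\<forall>j. \<exists>r. r \<in> R j \<and> snd r x \<noteq> 0 \<and> snd r x * h j x = fst r x"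
      using R(3) by (metis fst_conv snd_conv)
    then obtain \<rho> where "\<forall>j. \<rho> j \<in> R j \<and> snd (\<rho> j) x \<noteq> 0 \<and> snd (\<rho> j) x * h j x = fst (\<rho> j) x"
      by (rule choice[THEN exE])
    then show ?thesis by (intro bexI[of _ \<rho>]) (auto simp: valid_def \<R>_def)
  qed
  have "\<forall>\<rho>\<in>\<R>. \<exists>c. (\<exists>\<gamma>\<in>exponents J d. c \<gamma> \<noteq> 0) \<and>
    (\<forall>x \<epsilon> y. \<epsilon> \<longlonglongrightarrow> 0 \<longrightarrow> (\<forall>n. 0 < \<epsilon> n) \<longrightarrow> (\<forall>n. \<forall>j\<in>J. h j (x n) = \<epsilon> n ^ \<omega> j) \<longrightarrow>
       (\<forall>j\<in>- J. (\<lambda>n. h j (x n)) \<longlonglongrightarrow> y j) \<longrightarrow> (\<exists>\<^sub>F n in sequentially. valid \<rho> (x n)) \<longrightarrow>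
       rat_poly J d c y = 0)"
  proof
    fix \<rho> assume "\<rho> \<in> \<R>"
    then have "\<rho> j \<in> R j" for j by (auto simp: \<R>_def)
    then have "fst (\<rho> j) \<in> polys_deg B C \<and> snd (\<rho> j) \<in> polys_deg B C" for j
      using C by blast
    then obtain c where c: "\<exists>\<gamma>\<in>exponents {} d. c \<gamma> \<noteq> 0"
      "\<forall>x y. (\<forall>j. snd (\<rho> j) x \<noteq> 0 \<and> snd (\<rho> j) x * y j = fst (\<rho> j) x) \<longrightarrow> rat_poly {} d c y = 0"
      using d[THEN spec, THEN spec, of "\<lambda>j. fst (\<rho> j)" "\<lambda>j. snd (\<rho> j)"] by auto
    have zero: "rat_poly {} d c (\<lambda>j. h j x) = 0" if "valid \<rho> x" for x
      using c(2) that by (simp add: valid_def)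
    from lowest_order_coefficient[OF \<omega>(2) c(1)] obtain c' where
      c': "\<exists>\<gamma>\<in>exponents J d. c' \<gamma> \<noteq> 0" and
      lim: "\<forall>Y \<epsilon> y. \<epsilon> \<longlonglongrightarrow> 0 \<longrightarrow> (\<forall>n. 0 < \<epsilon> n) \<longrightarrow> (\<forall>n. \<forall>j\<in>J. Y n j = \<epsilon> n ^ \<omega> j) \<longrightarrow>
       (\<forall>j\<in>- J. (\<lambda>n. Y n j) \<longlonglongrightarrow> y j) \<longrightarrow> (\<exists>\<^sub>F n in sequentially. rat_poly {} d c (Y n) = 0) \<longrightarrow>
       rat_poly J d c' y = 0"
      by (elim exE conjE) (rule that)
    show "\<exists>c. (\<exists>\<gamma>\<in>exponents J d. c \<gamma> \<noteq> 0) \<and>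
      (\<forall>x \<epsilon> y. \<epsilon> \<longlonglongrightarrow> 0 \<longrightarrow> (\<forall>n. 0 < \<epsilon> n) \<longrightarrow> (\<forall>n. \<forall>j\<in>J. h j (x n) = \<epsilon> n ^ \<omega> j) \<longrightarrow>
       (\<forall>j\<in>- J. (\<lambda>n. h j (x n)) \<longlonglongrightarrow> y j) \<longrightarrow> (\<exists>\<^sub>F n in sequentially. valid \<rho> (x n)) \<longrightarrow>
       rat_poly J d c y = 0)"
    proof (intro exI[of _ c'] conjI c' allI impI)
      fix x \<epsilon> y
      assume *: "\<epsilon> \<longlonglongrightarrow> 0" "\<forall>n. 0 < \<epsilon> n" "\<forall>n. \<forall>j\<in>J. h j (x n) = \<epsilon> n ^ \<omega> j"
        "\<forall>j\<in>- J. (\<lambda>n. h j (x n)) \<longlonglongrightarrow> y j" and fr: "\<exists>\<^sub>F n in sequentially. valid \<rho> (x n)"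
      have "\<exists>\<^sub>F n in sequentially. rat_poly {} d c (\<lambda>j. h j (x n)) = 0"
        using fr by (rule frequently_elim1) (rule zero)
      with lim[rule_format, of \<epsilon> "\<lambda>n j. h j (x n)" y] * show "rat_poly J d c' y = 0" by blast
    qed
  qed
  then obtain c where c: "\<forall>\<rho>\<in>\<R>. (\<exists>\<gamma>\<in>exponents J d. c \<rho> \<gamma> \<noteq> 0) \<and>
    (\<forall>x \<epsilon> y. \<epsilon> \<longlonglongrightarrow> 0 \<longrightarrow> (\<forall>n. 0 < \<epsilon> n) \<longrightarrow> (\<forall>n. \<forall>j\<in>J. h j (x n) = \<epsilon> n ^ \<omega> j) \<longrightarrow>
       (\<forall>j\<in>- J. (\<lambda>n. h j (x n)) \<longlonglongrightarrow> y j) \<longrightarrow> (\<exists>\<^sub>F n in sequentially. valid \<rho> (x n)) \<longrightarrow>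
       rat_poly J d (c \<rho>) y = 0)"
    by (rule bchoice[THEN exE])
  show ?thesis
  proof (intro exI[of _ d] exI[of _ \<omega>] exI[of _ "c ` \<R>"] conjI \<omega>(1) allI impI)
    show "finite (c ` \<R>)" using \<open>finite \<R>\<close> by (rule finite_imageI)
    show "\<forall>c\<in>c ` \<R>. \<exists>\<gamma>\<in>exponents J d. c \<gamma> \<noteq> 0" using c by simp
    fix x \<epsilon> y
    assume *: "\<epsilon> \<longlonglongrightarrow> 0" "\<forall>n. 0 < \<epsilon> n" "\<forall>n. \<forall>j\<in>J. h j (x n) = \<epsilon> n ^ \<omega> j"
      "\<forall>j\<in>- J. (\<lambda>n. h j (x n)) \<longlonglongrightarrow> y j"
    obtain \<rho> where \<rho>: "\<rho> \<in> \<R>" "\<exists>\<^sub>F n in sequentially. valid \<rho> (x n)"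
      using frequently_finite_choice[OF \<open>finite \<R>\<close>, of "\<lambda>\<rho> n. valid \<rho> (x n)"] ex_valid by auto
    have "rat_poly J d (c \<rho>) y = 0"
      using bspec[OF c \<rho>(1), THEN conjunct2, rule_format, of \<epsilon> x y] * \<rho>(2) by blast
    then show "\<exists>c\<in>c ` \<R>. rat_poly J d c y = 0" using \<rho>(1) by blast
  qed
qed

section \<open>The Shapley operator is piecewise rational\<close>

context function_ring
begin

text \<open>The linear program of the matrix game: the constraints \<open>C1\<close> and \<open>C2\<close> describe the mixed actions \<open>z\<close> of
  the row player, and \<open>C3\<close> says that \<open>z\<close> secures \<open>v\<close> against each column.\<close>
lemma shapley_piecewise_rational:
  fixes G :: "('s::finite) stochastic_game"
  assumes G: "stochastic_game G" and b: "b \<in> P" and U: "\<And>s. U s \<in> P"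
    and r: "\<And>i j. i \<in> {1..actsI G s} \<Longrightarrow> j \<in> {1..actsII G s} \<Longrightarrow> (\<lambda>_. reward G s i j) \<in> P"
    and p: "\<And>i j s'. i \<in> {1..actsI G s} \<Longrightarrow> j \<in> {1..actsII G s} \<Longrightarrow> (\<lambda>_. pmf (trans G s i j) s') \<in> P"
  shows "piecewise_rational UNIV (\<lambda>x. shapley G (b x) (\<lambda>s. U s x) s)"
proof -
  define m n where "m = actsI G s" and "n = actsII G s"
  have mn: "m \<ge> 1" "n \<ge> 1" using G by (auto simp: m_def n_def stochastic_game_def)
  define A where "A i j = (\<lambda>x. stage_game G (b x) (\<lambda>s. U s x) s i j)" for i j
  have A: "A i j \<in> P" if "i \<in> {1..m}" "j \<in> {1..n}" for i j
    unfolding A_def stage_game_def using that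
    by (intro add_closed mult_closed diff_closed one_closed sum_closed b U r p)
      (auto simp: m_def n_def)
  define C1 where "C1 = (\<lambda>a. ((\<lambda>i (_ :: 'x). if i = a then - 1 else 0 :: real),
      (\<lambda>_ :: 'x. 0 :: real), (\<lambda>_ :: 'x. 0 :: real))) ` {1..m}"
  define C2 where "C2 = {((\<lambda>(_ :: nat) (_ :: 'x). 1 :: real), (\<lambda>_ :: 'x. 0 :: real), (\<lambda>_ :: 'x. 1 :: real)),
      ((\<lambda>_ _. - 1), (\<lambda>_. 0), (\<lambda>_. - 1))}"
  define C3 where "C3 = (\<lambda>j. ((\<lambda>i x. - A i j x), (\<lambda>_ :: 'x. 1 :: real), (\<lambda>_ :: 'x. 0 :: real))) ` {1..n}"
  have feas: "feasible {1..m} (C1 \<union> C2 \<union> C3) x = guaranteed m n (\<lambda>i j. A i j x)" for x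
  proof -
    have "(\<forall>(a, p, q)\<in>C1 \<union> C2 \<union> C3. (\<Sum>i\<in>{1..m}. a i x * z i) + p x * v \<le> q x) \<longleftrightarrow>
       (\<forall>a\<in>{1..m}. 0 \<le> z a) \<and> (\<Sum>a\<in>{1..m}. z a) = 1 \<and>
       (\<forall>j\<in>{1..n}. v \<le> (\<Sum>a\<in>{1..m}. z a * A a j x))" for z v
    proof -
      have "(\<Sum>i\<in>{1..m}. (if i = a then - 1 else 0) * z i) = - z a" if "a \<in> {1..m}" for a
        using that by (subst sum.remove[of _ a]) (auto intro!: sum.neutral)
      then have 1: "(\<forall>(a, p, q)\<in>C1. (\<Sum>i\<in>{1..m}. a i x * z i) + p x * v \<le> q x) \<longleftrightarrow>
          (\<forall>a\<in>{1..m}. 0 \<le> z a)"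
        by (simp add: C1_def)
      have 2: "(\<forall>(a, p, q)\<in>C2. (\<Sum>i\<in>{1..m}. a i x * z i) + p x * v \<le> q x) \<longleftrightarrow>
          (\<Sum>a\<in>{1..m}. z a) = 1"
        by (auto simp: C2_def sum_negf)
      have "(\<Sum>i\<in>{1..m}. - A i j x * z i) + 1 * v \<le> 0 \<longleftrightarrow> v \<le> (\<Sum>a\<in>{1..m}. z a * A a j x)" for j
        by (simp add: sum_negf mult.commute)
      then have 3: "(\<forall>(a, p, q)\<in>C3. (\<Sum>i\<in>{1..m}. a i x * z i) + p x * v \<le> q x) \<longleftrightarrow>
          (\<forall>j\<in>{1..n}. v \<le> (\<Sum>a\<in>{1..m}. z a * A a j x))"
        by (simp add: C3_def)
      show ?thesis by (simp only: ball_Un 1 2 3 conj_assoc)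
    qed
    then show ?thesis by (simp only: feasible_def guaranteed_def)
  qed
  show ?thesis
  proof (rule piecewise_rational_Sup_feasible)
    show "finite {1..m}" "finite (C1 \<union> C2 \<union> C3)" by (auto simp: C1_def C2_def C3_def)
    show "(\<forall>i\<in>{1..m}. piecewise_rational UNIV (a i)) \<and> piecewise_rational UNIV p \<and> piecewise_rational UNIV q"
      if "(a, p, q) \<in> C1 \<union> C2 \<union> C3" for a p q
    proof -
      have const: "(\<lambda>_. 0) \<in> P" "(\<lambda>_. 1) \<in> P" "(\<lambda>_. - 1) \<in> P"
        using zero_closed one_closed uminus_closed[OF one_closed] by auto
      have "(\<forall>i\<in>{1..m}. a i \<in> P) \<and> p \<in> P \<and> q \<in> P"
        using that const uminus_closed[OF A] by (auto simp: C1_def C2_def C3_def)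
      then show ?thesis using piecewise_rational_ring by blast
    qed
    fix x
    show "feasible {1..m} (C1 \<union> C2 \<union> C3) x \<noteq> {} \<and> bdd_above (feasible {1..m} (C1 \<union> C2 \<union> C3) x) \<and>
        shapley G (b x) (\<lambda>s. U s x) s = Sup (feasible {1..m} (C1 \<union> C2 \<union> C3) x)"
      unfolding feas using guaranteed_nonempty[OF mn(1)] guaranteed_bdd_above[OF mn(2)]
      by (simp add: shapley_def matrix_value_def m_def n_def A_def)
  qed
qed

end

section \<open>Approaching the value vector by perturbed fixed points\<close>

text \<open>The perturbation of state \<open>s\<close> is the power \<open>\<omega> s\<close> of \<open>1 / (n + 1)\<close>. Since \<open>\<omega> s\<close> is positive, the perturbation tends to
  \<open>0\<close>, and the perturbed fixed points tend to the value vector.\<close>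
lemma perturbed_sequence:
  fixes G :: "('s::finite) stochastic_game"
  assumes G: "stochastic_game G" and \<beta>: "0 < \<beta>" "\<beta> < 1" and \<omega>: "\<And>s. 1 \<le> \<omega> s"
  shows "\<exists>u. (\<forall>n s. u n s - shapley G \<beta> (u n) s = inverse (real (Suc n)) ^ \<omega> s) \<and>
             (\<forall>s. (\<lambda>n. u n s) \<longlonglongrightarrow> discounted_value G \<beta> s)"
proof -
  have \<beta>': "0 \<le> \<beta>" using \<beta> by simp
  define v where "v = discounted_value G \<beta>"
  have v: "v s = shapley G \<beta> v s" for s
  proof -
    obtain u where u: "\<forall>s. u s = 0 + shapley G \<beta> u s"
      using perturbed_shapley_fixpoint_exists[OF G \<beta>' \<beta>(2), of "\<lambda>_. 0"] by blast
    then have u': "u s = shapley G \<beta> u s" for s by (metis add_0_left)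
    have "v = u"
      unfolding v_def by (intro ext discounted_value_eq_fixpoint[OF G \<beta>] u')
    with u' show ?thesis by metis
  qed
  define e where "e n = inverse (real (Suc n))" for n
  have e: "0 < e n" "e n \<le> 1" for n by (auto simp: e_def field_simps)
  have "\<forall>n. \<exists>u. \<forall>s. u s = e n ^ \<omega> s + shapley G \<beta> u s"
    by (intro allI perturbed_shapley_fixpoint_exists[OF G \<beta>' \<beta>(2)])
  then obtain u where u: "\<forall>n s. u n s = e n ^ \<omega> s + shapley G \<beta> (u n) s"
    by (rule choice[THEN exE])
  have close: "\<bar>u n s - v s\<bar> \<le> e n / (1 - \<beta>)" for n s
  proof (rule shapley_fixpoint_stable[OF G \<beta>' \<beta>(2)])
    show "u n s = e n ^ \<omega> s + shapley G \<beta> (u n) s" "v s = shapley G \<beta> v s" for s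
      using u v by auto
    have "e n ^ \<omega> s \<le> e n ^ 1" for s using e[of n] \<omega> by (intro power_decreasing) auto
    then show "\<bar>e n ^ \<omega> s\<bar> \<le> e n" for s using e(1)[of n] by (simp add: less_imp_le)
  qed
  have "(\<lambda>n. u n s) \<longlonglongrightarrow> v s" for s
  proof (rule LIM_zero_cancel, rule Lim_null_comparison)
    show "\<forall>\<^sub>F n in sequentially. norm (u n s - v s) \<le> e n / (1 - \<beta>)" using close by simp
    show "(\<lambda>n. e n / (1 - \<beta>)) \<longlonglongrightarrow> 0"
      unfolding e_def using LIMSEQ_inverse_real_of_nat by (rule tendsto_divide_zero)
  qed
  with u show ?thesis unfolding e_def v_def by (intro exI[of _ u]) simp
qed

section \<open>Bivariate polynomials with rational coefficients\<close>

lemma poly_map_of_real: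
  "poly (map_poly complex_of_real p) (complex_of_real x) = complex_of_real (poly p x)"
  by (induction p) (simp_all add: map_poly_pCons)

lemma eval_bivariate_of_real:
  "eval_bivariate g (complex_of_real \<beta>) (complex_of_real z) = complex_of_real (poly (poly g [:z:]) \<beta>)"
  unfolding eval_bivariate_def
  by (induction g) (simp_all add: map_poly_pCons poly_map_of_real)

definition rational_coeffs :: "real poly poly \<Rightarrow> bool" where
  "rational_coeffs g \<longleftrightarrow> (\<forall>i j. coeff (coeff g i) j \<in> \<rat>)"

lemma rational_coeffs_mult: "rational_coeffs f \<Longrightarrow> rational_coeffs g \<Longrightarrow> rational_coeffs (f * g)"
  by (auto simp: rational_coeffs_def coeff_mult coeff_sum intro!: Rats_sum Rats_mult)

lemma rational_coeffs_prod:
  "(\<And>c. c \<in> S \<Longrightarrow> rational_coeffs (g c)) \<Longrightarrow> rational_coeffs (\<Prod>c\<in>S. g c)"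
proof (induction S rule: infinite_finite_induct)
  case (insert c S)
  then show ?case by (simp add: rational_coeffs_mult)
qed (auto simp: rational_coeffs_def coeff_1)

lemma prod_UNIV_option: "(\<Prod>x\<in>UNIV. f x) = f None * (\<Prod>x\<in>UNIV. f (Some x))"
  for f :: "'a::finite option \<Rightarrow> real"
  by (simp add: UNIV_option_conv prod.reindex)

lemma sum_only_term:
  assumes "finite S" "a \<in> S" "\<And>x. x \<in> S \<Longrightarrow> Q x \<longleftrightarrow> x = a"
  shows "(\<Sum>x\<in>S. if Q x then f x else 0) = f a"
proof -
  have "(\<Sum>x\<in>S. if Q x then f x else 0) = (\<Sum>x\<in>S. if x = a then f x else 0)"
    using assms(3) by (intro sum.cong) auto
  then show ?thesis using assms(1,2) by simp
qed

text \<open>With the variables of \<open>J\<close> gone, only \<open>Some None\<close> and \<open>None\<close> are left; they become the inner and the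
  outer variable of the bivariate polynomial. An exponent vector is determined by its two
  entries there, so no two terms of \<open>g\<close> merge.\<close>
lemma bivariate_of_rat_poly:
  fixes c :: "('s::finite option option \<Rightarrow> nat) \<Rightarrow> rat"
  defines "J \<equiv> range (\<lambda>s. Some (Some s))"
  assumes c: "\<exists>\<gamma>\<in>exponents J d. c \<gamma> \<noteq> 0"
  shows "\<exists>g. g \<noteq> 0 \<and> rational_coeffs g \<and> (\<forall>y. poly (poly g [:y None:]) (y (Some None)) = rat_poly J d c y)"
proof -
  define g :: "real poly poly" where
    "g = (\<Sum>\<gamma>\<in>exponents J d. monom (monom (of_rat (c \<gamma>)) (\<gamma> (Some None))) (\<gamma> None))"
  obtain \<gamma>1 where \<gamma>1: "\<gamma>1 \<in> exponents J d" "c \<gamma>1 \<noteq> 0" using c by blast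
  have coeff_g: "coeff (coeff g i) j = (\<Sum>\<gamma>\<in>exponents J d.
      if \<gamma> None = i \<and> \<gamma> (Some None) = j then of_rat (c \<gamma>) else 0)" for i j
    by (auto simp: g_def coeff_sum intro!: sum.cong)
  have determined: "\<gamma> None = \<gamma>1 None \<and> \<gamma> (Some None) = \<gamma>1 (Some None) \<longleftrightarrow> \<gamma> = \<gamma>1"
    if "\<gamma> \<in> exponents J d" for \<gamma>
  proof
    assume eq: "\<gamma> None = \<gamma>1 None \<and> \<gamma> (Some None) = \<gamma>1 (Some None)"
    show "\<gamma> = \<gamma>1"
    proof
      fix o' :: "'s option option"
      consider "o' = None" | "o' = Some None" | s where "o' = Some (Some s)"
        by (metis not_None_eq)
      then show "\<gamma> o' = \<gamma>1 o'"
        using eq that \<gamma>1(1) by cases (auto simp: exponents_def J_def)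
    qed
  qed simp
  have "coeff (coeff g (\<gamma>1 None)) (\<gamma>1 (Some None)) = of_rat (c \<gamma>1)"
    unfolding coeff_g by (rule sum_only_term[OF finite_exponents \<gamma>1(1) determined])
  then have "g \<noteq> 0" using \<gamma>1(2) by auto
  moreover have "rational_coeffs g"
    by (auto simp: rational_coeffs_def coeff_g intro!: Rats_sum)
  moreover have "poly (poly g [:y None:]) (y (Some None)) = rat_poly J d c y" for y
    unfolding g_def rat_poly_def poly_sum
  proof (rule sum.cong[OF refl])
    fix \<gamma> assume "\<gamma> \<in> exponents J d"
    then have "\<gamma> (Some (Some s)) = 0" for s by (simp add: exponents_def J_def)
    then have "monomial \<gamma> y = y None ^ \<gamma> None * y (Some None) ^ \<gamma> (Some None)"
      by (simp add: monomial_def prod_UNIV_option)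
    then show "poly (poly (monom (monom (of_rat (c \<gamma>)) (\<gamma> (Some None))) (\<gamma> None)) [:y None:]) (y (Some None))
        = of_rat (c \<gamma>) * monomial \<gamma> y"
      by (simp add: poly_monom poly_power)
  qed
  ultimately show ?thesis by blast
qed

lemma algebraic_of_rat_poly:
  fixes c :: "('s::finite option \<Rightarrow> nat) \<Rightarrow> rat"
  defines "J \<equiv> range Some"
  assumes c: "\<exists>\<gamma>\<in>exponents J d. c \<gamma> \<noteq> 0" and zero: "rat_poly J d c y = 0"
  shows "algebraic (y None)"
proof -
  define g :: "real poly" where "g = (\<Sum>\<gamma>\<in>exponents J d. monom (of_rat (c \<gamma>)) (\<gamma> None))"
  obtain \<gamma>1 where \<gamma>1: "\<gamma>1 \<in> exponents J d" "c \<gamma>1 \<noteq> 0" using c by blast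
  have coeff_g: "coeff g i = (\<Sum>\<gamma>\<in>exponents J d. if \<gamma> None = i then of_rat (c \<gamma>) else 0)" for i
    by (auto simp: g_def coeff_sum intro!: sum.cong)
  have determined: "\<gamma> None = \<gamma>1 None \<longleftrightarrow> \<gamma> = \<gamma>1" if "\<gamma> \<in> exponents J d" for \<gamma>
  proof
    assume eq: "\<gamma> None = \<gamma>1 None"
    show "\<gamma> = \<gamma>1"
    proof
      fix o' show "\<gamma> o' = \<gamma>1 o'"
        using eq that \<gamma>1(1) by (cases o') (auto simp: exponents_def J_def)
    qed
  qed simp
  have "coeff g (\<gamma>1 None) = of_rat (c \<gamma>1)"
    unfolding coeff_g by (rule sum_only_term[OF finite_exponents \<gamma>1(1) determined])
  then have "g \<noteq> 0" using \<gamma>1(2) by auto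
  moreover have "coeff g i \<in> \<rat>" for i by (auto simp: coeff_g intro!: Rats_sum)
  moreover have "poly g (y None) = rat_poly J d c y"
    unfolding g_def rat_poly_def poly_sum
  proof (rule sum.cong[OF refl])
    fix \<gamma> assume "\<gamma> \<in> exponents J d"
    then have "\<gamma> (Some s) = 0" for s by (simp add: exponents_def J_def)
    then have "monomial \<gamma> y = y None ^ \<gamma> None"
      by (simp add: monomial_def prod_UNIV_option)
    then show "poly (monom (of_rat (c \<gamma>)) (\<gamma> None)) (y None) = of_rat (c \<gamma>) * monomial \<gamma> y"
      by (simp add: poly_monom)
  qed
  ultimately show ?thesis using zero by (intro algebraicI'[of g]) auto
qed

section \<open>Algebraicity of the discounted value\<close>

lemma algebraic_game_spans_algebra:
  fixes G :: "('s::finite) stochastic_game"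
  assumes "algebraic_game G" "finite A" "\<And>a. a \<in> A \<Longrightarrow> algebraic a"
  shows "\<exists>B :: ('x \<Rightarrow> real) set. spans_algebra B \<and> (\<forall>a\<in>A. (\<lambda>_. a) \<in> rat_fun.span B) \<and>
    (\<forall>s. \<forall>i\<in>{1..actsI G s}. \<forall>j\<in>{1..actsII G s}. (\<lambda>_. reward G s i j) \<in> rat_fun.span B \<and>
       (\<forall>s'. (\<lambda>_. pmf (trans G s i j) s') \<in> rat_fun.span B))"
proof -
  define D where "D = A \<union> (\<Union>s. \<Union>i\<in>{1..actsI G s}. \<Union>j\<in>{1..actsII G s}.
      insert (reward G s i j) (range (pmf (trans G s i j))))"
  have "finite D" unfolding D_def using assms(2) by simp
  moreover have "algebraic a" if "a \<in> D" for a
    using that assms(1,3) by (auto simp: D_def algebraic_game_def real_algebraic_numbers_def)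
  ultimately obtain B :: "('x \<Rightarrow> real) set" where
    B: "spans_algebra B" "\<forall>a\<in>D. (\<lambda>_. a) \<in> rat_fun.span B"
    using ex_spans_algebra[of D] by blast
  have mem: "reward G s i j \<in> D" "pmf (trans G s i j) s' \<in> D"
    if "i \<in> {1..actsI G s}" "j \<in> {1..actsII G s}" for s i j s'
    using that unfolding D_def by blast+
  have "\<forall>a\<in>A. (\<lambda>_. a) \<in> rat_fun.span B" using B(2) by (simp add: D_def)
  with B mem show ?thesis by (intro exI[of _ B] conjI allI ballI) auto
qed

text \<open>The index type \<open>'s option\<close> of the variables stands for \<open>\<beta>\<close> (\<open>None\<close>) and the coordinates of \<open>u\<close>. The functions to be
  related are indexed by \<open>'s option option\<close>: \<open>None\<close> is the coordinate \<open>u s0\<close>, \<open>Some None\<close> is \<open>\<beta>\<close>, and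
  \<open>Some (Some s)\<close> is the perturbation \<open>w s\<close>.\<close>
lemma ex_annihilating_polynomial:
  fixes G :: "('s::finite) stochastic_game"
  assumes G: "stochastic_game G" and alg: "algebraic_game G"
  shows "\<exists>g. g \<noteq> 0 \<and> rational_coeffs g \<and>
    (\<forall>\<beta>\<in>{0<..<1}. poly (poly g [:discounted_value G \<beta> s0:]) \<beta> = 0)"
proof -
  obtain B :: "(('s option \<Rightarrow> real) \<Rightarrow> real) set" where B: "spans_algebra B" and
    data: "\<forall>s. \<forall>i\<in>{1..actsI G s}. \<forall>j\<in>{1..actsII G s}. (\<lambda>_. reward G s i j) \<in> rat_fun.span B \<and>
       (\<forall>s'. (\<lambda>_. pmf (trans G s i j) s') \<in> rat_fun.span B)"
    using algebraic_game_spans_algebra[OF alg, of "{}"] by auto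
  interpret function_ring "polys B" by (rule function_ring_polys[OF B])
  define h where "h k = (case k of None \<Rightarrow> (\<lambda>x. x (Some s0)) | Some None \<Rightarrow> (\<lambda>x. x None)
      | Some (Some s) \<Rightarrow> (\<lambda>x. x (Some s) - shapley G (x None) (\<lambda>s. x (Some s)) s))"
    for k :: "'s option option"
  note coord = coordinate_in_polys[OF B]
  have shap: "piecewise_rational UNIV (\<lambda>x. shapley G (x None) (\<lambda>s. x (Some s)) s)" for s
    using data constant_in_polys[OF B]
    by (intro shapley_piecewise_rational[OF G, where U = "\<lambda>s x. x (Some s)"] coord) auto
  have h: "piecewise_rational UNIV (h k)" for k
    unfolding h_def
    by (auto split: option.split intro: piecewise_rational_ring[OF coord]
        piecewise_rational_diff[OF piecewise_rational_ring[OF coord] shap])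
  define J where "J = range (\<lambda>s :: 's. Some (Some s))"
  have "CARD('s option) < CARD('s option option)" by simp
  from elimination[where h = h and J = J, OF B this h] obtain d \<omega> Q where Q: "finite Q"
      "\<forall>c\<in>Q. \<exists>\<gamma>\<in>exponents J d. c \<gamma> \<noteq> 0" and \<omega>: "\<forall>j. 1 \<le> \<omega> j" and
    elim: "\<forall>x \<epsilon> y. \<epsilon> \<longlonglongrightarrow> 0 \<longrightarrow> (\<forall>n. 0 < \<epsilon> n) \<longrightarrow> (\<forall>n. \<forall>j\<in>J. h j (x n) = \<epsilon> n ^ \<omega> j) \<longrightarrow>
       (\<forall>j\<in>- J. (\<lambda>n. h j (x n)) \<longlonglongrightarrow> y j) \<longrightarrow> (\<exists>c\<in>Q. rat_poly J d c y = 0)"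
    by (elim exE conjE) (rule that)
  have "\<forall>c\<in>Q. \<exists>g. g \<noteq> 0 \<and> rational_coeffs g \<and>
      (\<forall>y. poly (poly g [:y None:]) (y (Some None)) = rat_poly J d c y)"
    using Q(2) unfolding J_def by (intro ballI bivariate_of_rat_poly) blast
  then obtain g where g: "\<forall>c\<in>Q. g c \<noteq> 0 \<and> rational_coeffs (g c) \<and>
      (\<forall>y. poly (poly (g c) [:y None:]) (y (Some None)) = rat_poly J d c y)"
    by (rule bchoice[THEN exE])
  have "poly (poly (\<Prod>c\<in>Q. g c) [:discounted_value G \<beta> s0:]) \<beta> = 0" if "\<beta> \<in> {0<..<1}" for \<beta>
  proof -
    have \<beta>: "0 < \<beta>" "\<beta> < 1" using that by auto
    obtain u where u: "\<forall>n s. u n s - shapley G \<beta> (u n) s = inverse (real (Suc n)) ^ \<omega> (Some (Some s))"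
        "\<forall>s. (\<lambda>n. u n s) \<longlonglongrightarrow> discounted_value G \<beta> s"
      using perturbed_sequence[OF G \<beta>, of "\<lambda>s. \<omega> (Some (Some s))"] \<omega> by auto
    define x where "x n = case_option \<beta> (u n)" for n
    define y where "y k = (case k of None \<Rightarrow> discounted_value G \<beta> s0 | Some _ \<Rightarrow> \<beta>)"
      for k :: "'s option option"
    have "\<exists>c\<in>Q. rat_poly J d c y = 0"
    proof (rule elim[rule_format])
      show "(\<lambda>n. inverse (real (Suc n))) \<longlonglongrightarrow> 0" by (rule LIMSEQ_inverse_real_of_nat)
      show "0 < inverse (real (Suc n))" for n by simp
      show "h j (x n) = inverse (real (Suc n)) ^ \<omega> j" if "j \<in> J" for j n
        using that u(1) by (auto simp: J_def h_def x_def)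
      show "(\<lambda>n. h j (x n)) \<longlonglongrightarrow> y j" if "j \<in> - J" for j
      proof (cases j)
        case None
        then show ?thesis using u(2) by (simp add: h_def x_def y_def)
      next
        case (Some k)
        have "k = None" using that Some by (cases k) (simp_all add: J_def)
        then show ?thesis using Some by (simp add: h_def x_def y_def)
      qed
    qed
    then obtain c where c: "c \<in> Q" "rat_poly J d c y = 0" ..
    have "poly (poly (g c) [:y None:]) (y (Some None)) = 0" using g c by simp
    then have "poly (poly (g c) [:discounted_value G \<beta> s0:]) \<beta> = 0" by (simp add: y_def)
    with c(1) Q(1) show ?thesis by (simp add: poly_prod prod_zero_iff) blast
  qed
  moreover have "(\<Prod>c\<in>Q. g c) \<noteq> 0" using g Q(1) by simp
  moreover have "rational_coeffs (\<Prod>c\<in>Q. g c)" using g by (intro rational_coeffs_prod) simp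
  ultimately show ?thesis by blast
qed

text \<open>The same elimination with \<open>\<beta>\<close> among the data: the variables are the coordinates of \<open>u\<close> only, and one
  function less has to be related.\<close>
lemma algebraic_discounted_value:
  fixes G :: "('s::finite) stochastic_game"
  assumes G: "stochastic_game G" and alg: "algebraic_game G" and \<beta>: "0 < \<beta>" "\<beta> < 1" "algebraic \<beta>"
  shows "algebraic (discounted_value G \<beta> s0)"
proof -
  obtain B :: "(('s \<Rightarrow> real) \<Rightarrow> real) set" where B: "spans_algebra B" and
    b: "(\<lambda>_. \<beta>) \<in> rat_fun.span B" and
    data: "\<forall>s. \<forall>i\<in>{1..actsI G s}. \<forall>j\<in>{1..actsII G s}. (\<lambda>_. reward G s i j) \<in> rat_fun.span B \<and>
       (\<forall>s'. (\<lambda>_. pmf (trans G s i j) s') \<in> rat_fun.span B)"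
    using algebraic_game_spans_algebra[OF alg, of "{\<beta>}"] \<beta>(3) by auto
  interpret function_ring "polys B" by (rule function_ring_polys[OF B])
  define h where "h k = (case k of None \<Rightarrow> (\<lambda>x. x s0)
      | Some s \<Rightarrow> (\<lambda>x. x s - shapley G \<beta> x s))" for k :: "'s option"
  note coord = coordinate_in_polys[OF B]
  have shap: "piecewise_rational UNIV (\<lambda>x. shapley G \<beta> x s)" for s
    using data constant_in_polys[OF B] b
    by (intro shapley_piecewise_rational[OF G, where U = "\<lambda>s x. x s" and b = "\<lambda>_. \<beta>"] coord) auto
  have h: "piecewise_rational UNIV (h k)" for k
    unfolding h_def
    by (auto split: option.split intro: piecewise_rational_ring[OF coord]
        piecewise_rational_diff[OF piecewise_rational_ring[OF coord] shap])
  define J where "J = range (Some :: 's \<Rightarrow> 's option)"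
  have "CARD('s) < CARD('s option)" by simp
  from elimination[where h = h and J = J, OF B this h] obtain d \<omega> Q where
      Q: "\<forall>c\<in>Q. \<exists>\<gamma>\<in>exponents J d. c \<gamma> \<noteq> 0" and \<omega>: "\<forall>j. 1 \<le> \<omega> j" and
    elim: "\<forall>x \<epsilon> y. \<epsilon> \<longlonglongrightarrow> 0 \<longrightarrow> (\<forall>n. 0 < \<epsilon> n) \<longrightarrow> (\<forall>n. \<forall>j\<in>J. h j (x n) = \<epsilon> n ^ \<omega> j) \<longrightarrow>
       (\<forall>j\<in>- J. (\<lambda>n. h j (x n)) \<longlonglongrightarrow> y j) \<longrightarrow> (\<exists>c\<in>Q. rat_poly J d c y = 0)"
    by (elim exE conjE) (rule that)
  obtain u where u: "\<forall>n s. u n s - shapley G \<beta> (u n) s = inverse (real (Suc n)) ^ \<omega> (Some s)"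
      "\<forall>s. (\<lambda>n. u n s) \<longlonglongrightarrow> discounted_value G \<beta> s"
    using perturbed_sequence[OF G \<beta>(1,2), of "\<lambda>s. \<omega> (Some s)"] \<omega> by auto
  define y where "y = (\<lambda>_ :: 's option. discounted_value G \<beta> s0)"
  have "\<exists>c\<in>Q. rat_poly J d c y = 0"
  proof (rule elim[rule_format])
    show "(\<lambda>n. inverse (real (Suc n))) \<longlonglongrightarrow> 0" by (rule LIMSEQ_inverse_real_of_nat)
    show "0 < inverse (real (Suc n))" for n by simp
    show "h j (u n) = inverse (real (Suc n)) ^ \<omega> j" if "j \<in> J" for j n
      using that u(1) by (auto simp: J_def h_def)
    show "(\<lambda>n. h j (u n)) \<longlonglongrightarrow> y j" if "j \<in> - J" for j
    proof -
      from that have "j = None" by (cases j) (auto simp: J_def)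
      then show ?thesis using u(2) by (simp add: h_def y_def)
    qed
  qed
  then obtain c where c: "c \<in> Q" "rat_poly J d c y = 0" ..
  have "algebraic (y None)"
    using Q c unfolding J_def by (intro algebraic_of_rat_poly[of d c y]) auto
  then show ?thesis by (simp add: y_def)
qed

theorem theorem3p1:
  fixes G :: "('s::finite) stochastic_game"
  assumes "stochastic_game G"
    and "algebraic_game G"
  shows "(\<exists>g :: 's \<Rightarrow> real poly poly.
            (\<forall>s. g s \<noteq> 0 \<and> algebraic_coeffs (g s)) \<and>
            (\<forall>\<beta>\<in>{0<..<1}.
               (complex_of_real \<beta>, \<chi> s. complex_of_real (discounted_value G \<beta> s)) \<in> variety_W g))
       \<and> (\<forall>\<beta>\<in>{0<..<1} \<inter> real_algebraic_numbers. \<forall>s. algebraic (discounted_value G \<beta> s))"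
proof
  have "\<forall>s. \<exists>g. g \<noteq> 0 \<and> rational_coeffs g \<and>
      (\<forall>\<beta>\<in>{0<..<1}. poly (poly g [:discounted_value G \<beta> s:]) \<beta> = 0)"
    using ex_annihilating_polynomial[OF assms] by blast
  then obtain g where g: "\<forall>s. g s \<noteq> 0 \<and> rational_coeffs (g s) \<and>
      (\<forall>\<beta>\<in>{0<..<1}. poly (poly (g s) [:discounted_value G \<beta> s:]) \<beta> = 0)"
    by (rule choice[THEN exE])
  show "\<exists>g :: 's \<Rightarrow> real poly poly.
            (\<forall>s. g s \<noteq> 0 \<and> algebraic_coeffs (g s)) \<and>
            (\<forall>\<beta>\<in>{0<..<1}.
               (complex_of_real \<beta>, \<chi> s. complex_of_real (discounted_value G \<beta> s)) \<in> variety_W g)"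
  proof (intro exI[of _ g] conjI allI ballI)
    fix s
    show "g s \<noteq> 0" using g by blast
    have "rational_coeffs (g s)" using g by blast
    then show "algebraic_coeffs (g s)"
      by (simp add: algebraic_coeffs_def real_algebraic_numbers_def rational_coeffs_def
          rat_imp_algebraic)
  next
    fix \<beta> :: real assume "\<beta> \<in> {0<..<1}"
    with g show "(complex_of_real \<beta>, \<chi> s. complex_of_real (discounted_value G \<beta> s)) \<in> variety_W g"
      by (simp add: variety_W_def eval_bivariate_of_real)
  qed
next
  show "\<forall>\<beta>\<in>{0<..<1} \<inter> real_algebraic_numbers. \<forall>s. algebraic (discounted_value G \<beta> s)"
    using algebraic_discounted_value[OF assms] by (simp add: real_algebraic_numbers_def)
qed

end
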